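(* Let $V$ and $H$ be separable Hilbert spaces such that the embedding $V\hookrightarrow H$ is dense and compact, let $\Sigma$ be a dictionary of $V$, and let $a:V\times V\to\mathbb{R}$ be a symmetric continuous bilinear form for which there exist $\gamma,\nu>0$ such that $a(v,v)\geq \gamma\|v\|_V^2-\nu\|v\|^2$ for all $v\in V$. Then the following properties hold for each of the four algorithms PRaGA, ORaGA, PReGA and OReGA (described in the context), $(z_n)_{n\geq 1}$, $(u_n)_{n\in\mathbb{N}}$ and $(\lambda_n)_{n\in\mathbb{N}}$ denoting any sequences produced by the algorithm: \begin{enumerate} \item All the iterations of the algorithm are well-defined (i.e. at each iteration $n\ge 1$ the minimization problems involved have at least one solution). \item The sequence $(\lambda_n)_{n\in\mathbb{N}}$ is non-increasing and converges towards a limit $\lambda$ which is an eigenvalue of $a(\cdot,\cdot)$ for the scalar product $\langle\cdot,\cdot\rangle$. \item The sequence $(u_n)_{n\in\mathbb{N}}$ is bounded in $V$, and any subsequence of $(u_n)_{n\in\mathbb{N}}$ which weakly converges in $V$ also strongly converges in $V$ towards an $H$-normalized eigenvector associated with $\lambda$. This implies in particular that $$d_a(u_n,F_\lambda):=\inf_{w\in F_\lambda}\|w-u_n\|_a\longrightarrow 0 \quad\text{as } n\to\infty,$$ where $F_\lambda$ denotes the set of the $H$-normalized eigenvectors of $a(\cdot,\cdot)$ associated with $\lambda$. \item If $\lambda$ is a simple eigenvalue, then there exists an $H$-normalized eigenvector $w_\lambda$ associated with $\lambda$ such that the whole sequence $(u_n)_{n\in\mathbb{N}}$ converges to $w_\lambda$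 strongly in $V$. \end{enumerate}
   Context: $V\subset H$ are real Hilbert spaces with scalar products $\langle\cdot,\cdot\rangle_V$, $\langle\cdot,\cdot\rangle$ and norms $\|\cdot\|_V$, $\|\cdot\|$ respectively. With $\nu$ as in the lower bound on $a$, set $\langle v,w\rangle_a:=a(v,w)+\nu\langle v,w\rangle$; this is a scalar product on $V$ whose norm $\|\cdot\|_a$ is equivalent to $\|\cdot\|_V$. The constant $\nu$ is fixed once and for all, and chosen (without loss of generality) so that $\|v\|_a\ge\|v\|$ for all $v\in V$. Eigenvalues: $\mu\in\mathbb{R}$ is an eigenvalue of $a(\cdot,\cdot)$ (for $\langle\cdot,\cdot\rangle$) with associated eigenvector $\psi\in V\setminus\{0\}$ if $a(\psi,v)=\mu\langle\psi,v\rangle$ for all $v\in V$; $\psi$ is $H$-normalized if $\|\psi\|=1$. Dictionary: $\Sigma\subset V$ is a dictionary of $V$ if (1) $0\in\Sigma$ and $tz\in\Sigma$ for all $(z,t)\in\Sigma\times\mathbb{R}$; (2) $\Sigma$ is weakly closed in $V$; (3) $\mathrm{Span}(\Sigma)$ is dense in $V$. Set $\Sigma^*:=\Sigma\setminus\{0\}$. Rayleigh quotient: $\mathcal{J}(v):=a(v,v)/\|v\|^2$ for $v\in V\setminus\{0\}$, $\mathcal{J}(0):=+\infty$; $\lambda_\Sigma:=\inf_{z\in\Sigma^*}\mathcal{J}(z)$. PRaGA (Pure Rayleigh Greedy Algorithm): choose $u_0\in V$ with $\|u_0\|=1$ and $\lambda_0:=a(u_0,u_0)<\lambda_\Sigma$.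 For $n\ge1$: find $z_n\in\operatorname{argmin}_{z\in\Sigma}\mathcal{J}(u_{n-1}+z)$, and set $u_n:=\frac{u_{n-1}+z_n}{\|u_{n-1}+z_n\|}$, $\lambda_n:=a(u_n,u_n)$. PReGA (Pure Residual Greedy Algorithm): choose $u_0\in V$ with $\|u_0\|=1$ and let $\lambda_0:=a(u_0,u_0)$. For $n\ge1$: find $z_n\in\operatorname{argmin}_{z\in\Sigma}\ \frac12\|u_{n-1}+z\|_a^2-(\lambda_{n-1}+\nu)\langle u_{n-1},z\rangle$, and set $u_n:=\frac{u_{n-1}+z_n}{\|u_{n-1}+z_n\|}$, $\lambda_n:=a(u_n,u_n)$. ORaGA / OReGA (orthogonal versions): choose $u_0\in V$ with $\|u_0\|=1$, let $\lambda_0:=a(u_0,u_0)$; for the ORaGA it is moreover required that $\lambda_0<\lambda_\Sigma$. For $n\ge 1$: find $z_n\in\Sigma$ solving the same minimization problem over $\Sigma$ as in the PRaGA (for the ORaGA), respectively the PReGA (for the OReGA), with the current $u_{n-1},\lambda_{n-1}$; then find $(c_0^{(n)},\dots,c_n^{(n)})\in\operatorname{argmin}_{(c_0,\dots,c_n)\in\mathbb{R}^{n+1}}\mathcal{J}(c_0u_0+c_1z_1+\cdots+c_nz_n)$ and set $u_n:=\frac{c_0^{(n)}u_0+c_1^{(n)}z_1+\cdots+c_n^{(n)}z_n}{\|c_0^{(n)}u_0+c_1^{(n)}z_1+\cdots+c_n^{(n)}z_n\|}$; if $\langle u_{n-1},u_n\rangle\le0$, replace $u_n$ by $-u_n$;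 set $\lambda_n:=a(u_n,u_n)$. *)

theory Defs
  imports "HOL-Analysis.Analysis"
begin

text \<open>
  The inclusion of V into H is rendered by an injective map \<open>\<iota> :: 'v \<Rightarrow> 'h\<close> between the types
  of the two Hilbert spaces. Norm, inner product and topology on \<open>'v\<close> are those of V;
  the H-scalar product of v, w in V is \<open>\<iota> v \<bullet> \<iota> w\<close>.
\<close>

definition weak_topology :: "'v::real_normed_vector topology" where
  "weak_topology = topology_generated_by
     {f -` U | (f :: 'v \<Rightarrow> real) U. bounded_linear f \<and> open U}"

definition dense_compact_embedding ::
    "('v::real_normed_vector \<Rightarrow> 'h::real_normed_vector) \<Rightarrow> bool" where
  "dense_compact_embedding \<iota> \<longleftrightarrow>
     bounded_linear \<iota> \<and> inj \<iota> \<and> closure (range \<iota>) = UNIV \<and>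
     (\<forall>B. bounded B \<longrightarrow> compact (closure (\<iota> ` B)))"

definition dictionary :: "'v::real_normed_vector set \<Rightarrow> bool" where
  "dictionary D \<longleftrightarrow>
     0 \<in> D \<and> (\<forall>z\<in>D. \<forall>t::real. t *\<^sub>R z \<in> D) \<and>
     closedin weak_topology D \<and>
     closure (span D) = UNIV"

definition norm_a ::
    "('v \<Rightarrow> 'h::real_inner) \<Rightarrow> ('v \<Rightarrow> 'v \<Rightarrow> real) \<Rightarrow> real \<Rightarrow> 'v \<Rightarrow> real" where
  "norm_a \<iota> a \<nu> v = sqrt (a v v + \<nu> * (\<iota> v \<bullet> \<iota> v))"

definition is_eigenvector ::
    "('v::zero \<Rightarrow> 'h::real_inner) \<Rightarrow> ('v \<Rightarrow> 'v \<Rightarrow> real) \<Rightarrow> real \<Rightarrow> 'v \<Rightarrow> bool" where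
  "is_eigenvector \<iota> a \<mu> \<psi> \<longleftrightarrow> \<psi> \<noteq> 0 \<and> (\<forall>v. a \<psi> v = \<mu> * (\<iota> \<psi> \<bullet> \<iota> v))"

definition is_eigenvalue ::
    "('v::zero \<Rightarrow> 'h::real_inner) \<Rightarrow> ('v \<Rightarrow> 'v \<Rightarrow> real) \<Rightarrow> real \<Rightarrow> bool" where
  "is_eigenvalue \<iota> a \<mu> \<longleftrightarrow> (\<exists>\<psi>. is_eigenvector \<iota> a \<mu> \<psi>)"

definition normalized_eigenvectors ::
    "('v::zero \<Rightarrow> 'h::real_inner) \<Rightarrow> ('v \<Rightarrow> 'v \<Rightarrow> real) \<Rightarrow> real \<Rightarrow> 'v set" where
  "normalized_eigenvectors \<iota> a \<mu> = {w. is_eigenvector \<iota> a \<mu> w \<and> norm (\<iota> w) = 1}"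

text \<open>
  The value of \<^const>\<open>dim\<close> is 0 on infinite-dimensional subspaces, so the equation below does say
  that the eigenspace is one-dimensional.
\<close>

definition is_simple_eigenvalue ::
    "('v::real_vector \<Rightarrow> 'h::real_inner) \<Rightarrow> ('v \<Rightarrow> 'v \<Rightarrow> real) \<Rightarrow> real \<Rightarrow> bool" where
  "is_simple_eigenvalue \<iota> a \<mu> \<longleftrightarrow>
     is_eigenvalue \<iota> a \<mu> \<and> dim (insert 0 {\<psi>. is_eigenvector \<iota> a \<mu> \<psi>}) = 1"

definition rayleigh ::
    "('v::zero \<Rightarrow> 'h::real_normed_vector) \<Rightarrow> ('v \<Rightarrow> 'v \<Rightarrow> real) \<Rightarrow> 'v \<Rightarrow> ereal" where
  "rayleigh \<iota> a v = (if v = 0 then \<infinity> else ereal (a v v / (norm (\<iota> v))\<^sup>2))"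

definition lambda_dict ::
    "('v::zero \<Rightarrow> 'h::real_normed_vector) \<Rightarrow> ('v \<Rightarrow> 'v \<Rightarrow> real) \<Rightarrow> 'v set \<Rightarrow> ereal" where
  "lambda_dict \<iota> a D = (INF z\<in>D - {0}. rayleigh \<iota> a z)"

datatype greedy_alg = PRaGA | ORaGA | PReGA | OReGA

definition uses_rayleigh :: "greedy_alg \<Rightarrow> bool" where
  "uses_rayleigh alg \<longleftrightarrow> alg = PRaGA \<or> alg = ORaGA"

definition is_orthogonal :: "greedy_alg \<Rightarrow> bool" where
  "is_orthogonal alg \<longleftrightarrow> alg = ORaGA \<or> alg = OReGA"

definition dict_objective ::
    "greedy_alg \<Rightarrow> ('v::real_vector \<Rightarrow> 'h::real_inner) \<Rightarrow> ('v \<Rightarrow> 'v \<Rightarrow> real) \<Rightarrow> real \<Rightarrow>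
     'v \<Rightarrow> real \<Rightarrow> 'v \<Rightarrow> ereal" where
  "dict_objective alg \<iota> a \<nu> u lam z =
     (if uses_rayleigh alg then rayleigh \<iota> a (u + z)
      else ereal ((norm_a \<iota> a \<nu> (u + z))\<^sup>2 / 2 - (lam + \<nu>) * (\<iota> u \<bullet> \<iota> z)))"

definition dict_argmin ::
    "greedy_alg \<Rightarrow> ('v::real_vector \<Rightarrow> 'h::real_inner) \<Rightarrow> ('v \<Rightarrow> 'v \<Rightarrow> real) \<Rightarrow> real \<Rightarrow> 'v set \<Rightarrow>
     'v \<Rightarrow> real \<Rightarrow> 'v \<Rightarrow> bool" where
  "dict_argmin alg \<iota> a \<nu> D u lam z \<longleftrightarrow>
     is_arg_min (dict_objective alg \<iota> a \<nu> u lam) (\<lambda>z. z \<in> D) z"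

definition lin_comb :: "'v::real_vector \<Rightarrow> (nat \<Rightarrow> 'v) \<Rightarrow> nat \<Rightarrow> (nat \<Rightarrow> real) \<Rightarrow> 'v" where
  "lin_comb u0 z n c = c 0 *\<^sub>R u0 + (\<Sum>i=1..n. c i *\<^sub>R z i)"

text \<open>The extensional functions on \<open>{..n}\<close> encode the coefficient vectors \<open>(c\<^sub>0, \<dots>, c\<^sub>n)\<close>.\<close>

definition coeff_argmin ::
    "('v::real_vector \<Rightarrow> 'h::real_normed_vector) \<Rightarrow> ('v \<Rightarrow> 'v \<Rightarrow> real) \<Rightarrow>
     'v \<Rightarrow> (nat \<Rightarrow> 'v) \<Rightarrow> nat \<Rightarrow> (nat \<Rightarrow> real) \<Rightarrow> bool" where
  "coeff_argmin \<iota> a u0 z n c \<longleftrightarrow>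
     is_arg_min (\<lambda>c. rayleigh \<iota> a (lin_comb u0 z n c)) (\<lambda>c. c \<in> {..n} \<rightarrow>\<^sub>E UNIV) c"

definition H_normalize :: "('v::real_vector \<Rightarrow> 'h::real_normed_vector) \<Rightarrow> 'v \<Rightarrow> 'v" where
  "H_normalize \<iota> v = v /\<^sub>R norm (\<iota> v)"

definition flip_sign :: "('v::real_vector \<Rightarrow> 'h::real_inner) \<Rightarrow> 'v \<Rightarrow> 'v \<Rightarrow> 'v" where
  "flip_sign \<iota> u w = (if \<iota> u \<bullet> \<iota> w \<le> 0 then - w else w)"

definition greedy_init ::
    "greedy_alg \<Rightarrow> ('v::real_vector \<Rightarrow> 'h::real_inner) \<Rightarrow> ('v \<Rightarrow> 'v \<Rightarrow> real) \<Rightarrow> 'v set \<Rightarrow>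
     'v \<Rightarrow> real \<Rightarrow> bool" where
  "greedy_init alg \<iota> a D u0 lam0 \<longleftrightarrow>
     norm (\<iota> u0) = 1 \<and> lam0 = a u0 u0 \<and>
     (uses_rayleigh alg \<longrightarrow> ereal lam0 < lambda_dict \<iota> a D)"

definition greedy_step ::
    "greedy_alg \<Rightarrow> ('v::real_vector \<Rightarrow> 'h::real_inner) \<Rightarrow> ('v \<Rightarrow> 'v \<Rightarrow> real) \<Rightarrow> real \<Rightarrow> 'v set \<Rightarrow>
     (nat \<Rightarrow> 'v) \<Rightarrow> (nat \<Rightarrow> 'v) \<Rightarrow> (nat \<Rightarrow> real) \<Rightarrow> nat \<Rightarrow> bool" where
  "greedy_step alg \<iota> a \<nu> D z u lam n \<longleftrightarrow>
     dict_argmin alg \<iota> a \<nu> D (u (n - 1)) (lam (n - 1)) (z n) \<and>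
     (if is_orthogonal alg
      then \<exists>c. coeff_argmin \<iota> a (u 0) z n c \<and>
               u n = flip_sign \<iota> (u (n - 1)) (H_normalize \<iota> (lin_comb (u 0) z n c))
      else u n = H_normalize \<iota> (u (n - 1) + z n)) \<and>
     lam n = a (u n) (u n)"

text \<open>
  A run of N iterations constrains only \<open>z 1, \<dots>, z N\<close>, \<open>u 0, \<dots>, u N\<close> and
  \<open>lam 0, \<dots>, lam N\<close>; the remaining entries of the sequences are arbitrary.
\<close>

definition greedy_run_upto ::
    "greedy_alg \<Rightarrow> ('v::real_vector \<Rightarrow> 'h::real_inner) \<Rightarrow> ('v \<Rightarrow> 'v \<Rightarrow> real) \<Rightarrow> real \<Rightarrow> 'v set \<Rightarrow>
     (nat \<Rightarrow> 'v) \<Rightarrow> (nat \<Rightarrow> 'v) \<Rightarrow> (nat \<Rightarrow> real) \<Rightarrow> nat \<Rightarrow> bool" where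
  "greedy_run_upto alg \<iota> a \<nu> D z u lam N \<longleftrightarrow>
     greedy_init alg \<iota> a D (u 0) (lam 0) \<and>
     (\<forall>n\<in>{1..N}. greedy_step alg \<iota> a \<nu> D z u lam n)"

definition greedy_run ::
    "greedy_alg \<Rightarrow> ('v::real_vector \<Rightarrow> 'h::real_inner) \<Rightarrow> ('v \<Rightarrow> 'v \<Rightarrow> real) \<Rightarrow> real \<Rightarrow> 'v set \<Rightarrow>
     (nat \<Rightarrow> 'v) \<Rightarrow> (nat \<Rightarrow> 'v) \<Rightarrow> (nat \<Rightarrow> real) \<Rightarrow> bool" where
  "greedy_run alg \<iota> a \<nu> D z u lam \<longleftrightarrow>
     greedy_init alg \<iota> a D (u 0) (lam 0) \<and>
     (\<forall>n\<ge>1. greedy_step alg \<iota> a \<nu> D z u lam n)"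

text \<open>
  Iteration n is well-defined if both minimization problems have solutions, whichever minimizer
  \<open>\<zeta>\<close> of the first one is used in the second. Since division by zero is total here, the
  definedness of the normalization of the new iterate is required explicitly.
\<close>

definition iteration_well_defined ::
    "greedy_alg \<Rightarrow> ('v::real_vector \<Rightarrow> 'h::real_inner) \<Rightarrow> ('v \<Rightarrow> 'v \<Rightarrow> real) \<Rightarrow> real \<Rightarrow> 'v set \<Rightarrow>
     (nat \<Rightarrow> 'v) \<Rightarrow> (nat \<Rightarrow> 'v) \<Rightarrow> (nat \<Rightarrow> real) \<Rightarrow> nat \<Rightarrow> bool" where
  "iteration_well_defined alg \<iota> a \<nu> D z u lam n \<longleftrightarrow>
     (\<exists>\<zeta>. dict_argmin alg \<iota> a \<nu> D (u (n - 1)) (lam (n - 1)) \<zeta>) \<and>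
     (\<forall>\<zeta>. dict_argmin alg \<iota> a \<nu> D (u (n - 1)) (lam (n - 1)) \<zeta> \<longrightarrow>
        (if is_orthogonal alg
         then (\<exists>c. coeff_argmin \<iota> a (u 0) (z(n := \<zeta>)) n c) \<and>
              (\<forall>c. coeff_argmin \<iota> a (u 0) (z(n := \<zeta>)) n c \<longrightarrow>
                   lin_comb (u 0) (z(n := \<zeta>)) n c \<noteq> 0)
         else u (n - 1) + \<zeta> \<noteq> 0))"

end

theory Submission
  imports Defs "HOL-Library.Diagonal_Subsequence"
begin

text \<open>
  Let \<open>e\<^sub>n = lam\<^sub>n - lam\<^sub>n\<^sub>+\<^sub>1\<close>. In all four algorithms \<open>lam\<^sub>n\<^sub>+\<^sub>1\<close> is at most the Rayleigh quotient of
  \<open>u\<^sub>n + z\<^sub>n\<^sub>+\<^sub>1\<close>, which is itself at most \<open>lam\<^sub>n\<close>, so \<open>lam\<close> decreases and \<open>e\<^sub>n\<close> tends to 0. Since the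
  dictionary is a cone, minimality of \<open>z\<^sub>n\<^sub>+\<^sub>1\<close> on each line spanned by some y in the dictionary says
  that a quadratic polynomial is nonnegative, and its discriminant bounds the residual
  \<open>a u\<^sub>n y - lam\<^sub>n * (\<iota> u\<^sub>n \<bullet> \<iota> y)\<close> by a multiple of \<open>sqrt e\<^sub>n\<close>. By density the residuals vanish in the limit
  on all of V, so weak limits of the iterates are eigenvectors; as the embedding is compact,
  they are normalized, and convergence of \<open>lam\<close> turns into convergence of the energy norms, which
  makes weak convergence strong.
\<close>

section \<open>Weak convergence in Hilbert spaces\<close>

text \<open>Three obstacles shape the argument. The Rayleigh quotient is not coercive in the
  correction, so a minimizing sequence over the dictionary could run off to infinity. The initial
  gap below \<open>lambda_dict\<close> excludes this, and since \<open>lam\<close> decreases, one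
  real number strictly inside the gap serves every iteration. The discriminant then bounds a
  residual formed with the quotient \<open>q\<close> of \<open>u + z\<close> instead of
  \<open>lam\<close>; the error is harmless because \<open>lam\<close> minus \<open>q\<close> is at
  most the decrement. The residual objective grows quadratically and needs no gap. Minimizing it
  does not minimize the quotient, however, and the resulting bound on the energy of the correction
  contains that correction on its right side as well. It becomes explicit only once the decrement is
  at most 1/4. A simple eigenvalue still has two normalized eigenvectors, \<open>w\<close> and
  \<open>- w\<close>. Convergence of the whole sequence therefore needs consecutive iterates not to
  point in opposite directions: the orthogonal versions enforce this by their sign rule, the pure
  ones because the corrections tend to 0 in H.\<close>

lemma topspace_weak_topology [simp]: "topspace weak_topology = UNIV"
proof -
  have "UNIV \<in> {f -` U | (f :: 'a \<Rightarrow> real) U. bounded_linear f \<and> open U}"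
    using bounded_linear_zero by (intro CollectI exI[of _ "\<lambda>_. 0"] exI[of _ UNIV]) auto
  then show ?thesis
    unfolding weak_topology_def topology_generated_by_topspace by blast
qed

text \<open>The preimages under functionals form only a subbasis, but eventual membership survives
  finite intersections and arbitrary unions, so it can be proved by induction over the generated
  topology.\<close>

lemma limitin_weak_topology:
  fixes x :: "'b \<Rightarrow> 'a::real_normed_vector"
  shows "limitin weak_topology x w F \<longleftrightarrow>
    (\<forall>f::'a \<Rightarrow> real. bounded_linear f \<longrightarrow> ((\<lambda>n. f (x n)) \<longlongrightarrow> f w) F)"
proof
  assume L: "limitin weak_topology x w F"
  show "\<forall>f::'a \<Rightarrow> real. bounded_linear f \<longrightarrow> ((\<lambda>n. f (x n)) \<longlongrightarrow> f w) F"
  proof (intro allI impI topological_tendstoI)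
    fix f :: "'a \<Rightarrow> real" and U assume f: "bounded_linear f" and U: "open U" "f w \<in> U"
    have "openin weak_topology (f -` U)"
      unfolding weak_topology_def by (rule topology_generated_by_Basis) (use f U in blast)
    then have "\<forall>\<^sub>F n in F. x n \<in> f -` U"
      using L U by (auto simp: limitin_def)
    then show "\<forall>\<^sub>F n in F. f (x n) \<in> U" by simp
  qed
next
  assume R: "\<forall>f::'a \<Rightarrow> real. bounded_linear f \<longrightarrow> ((\<lambda>n. f (x n)) \<longlongrightarrow> f w) F"
  have "\<forall>\<^sub>F n in F. x n \<in> U"
    if "generate_topology_on {f -` U | (f :: 'a \<Rightarrow> real) U. bounded_linear f \<and> open U} U" "w \<in> U" for U
    using that
  proof (induction rule: generate_topology_on.induct)
    case (Int S T)
    then show ?case by (auto intro: eventually_conj)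
  next
    case (UN K)
    then obtain k where "k \<in> K" "w \<in> k" by blast
    with UN.IH have "\<forall>\<^sub>F n in F. x n \<in> k" by blast
    then show ?case by (rule eventually_mono) (use \<open>k \<in> K\<close> in blast)
  next
    case (Basis S)
    then obtain f :: "'a \<Rightarrow> real" and T where "S = f -` T" "bounded_linear f" "open T" by blast
    with R Basis show ?case by (auto simp: tendsto_def)
  qed auto
  then show "limitin weak_topology x w F"
    unfolding limitin_def topspace_weak_topology
    by (simp add: weak_topology_def openin_topology_generated_by_iff)
qed

lemma limitin_weak_topologyD:
  fixes f :: "'a::real_normed_vector \<Rightarrow> real"
  assumes "limitin weak_topology x w F" "bounded_linear f"
  shows "((\<lambda>n. f (x n)) \<longlongrightarrow> f w) F"
  using assms by (simp add: limitin_weak_topology)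

text \<open>The representing vector is the minimizer of the strictly convex functional
  \<open>E\<close>; completeness supplies it, and vanishing of the first variation is the
  claim.\<close>

lemma Riesz_representation:
  fixes f :: "'a::{real_inner, complete_space} \<Rightarrow> real"
  assumes "bounded_linear f"
  obtains w where "\<And>v. f v = w \<bullet> v"
proof -
  interpret f: bounded_linear f by fact
  define E where "E v = (norm v)\<^sup>2 / 2 - f v" for v
  obtain K where K: "\<And>v. norm (f v) \<le> norm v * K" "K \<ge> 0"
    using f.nonneg_bounded by blast
  have low: "E v \<ge> - (K\<^sup>2 / 2)" for v
  proof -
    have "f v \<le> norm v * K" using K(1)[of v] by simp
    moreover have "0 \<le> (norm v - K)\<^sup>2" by simp
    ultimately show ?thesis unfolding E_def by (simp add: power2_eq_square algebra_simps)
  qed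
  define m where "m = Inf (range E)"
  have bdd: "bdd_below (range E)" using low by (auto intro!: bdd_belowI2)
  have mle: "m \<le> E v" for v unfolding m_def by (intro cInf_lower bdd) auto
  have "\<exists>v. E v < m + 1 / Suc n" for n
    using cInf_lessD[of "range E" "m + 1 / Suc n"] unfolding m_def by auto
  then obtain x where x: "\<And>n. E (x n) < m + 1 / Suc n" by metis
  \<comment> \<open>The parallelogram identity: the linear part of \<open>E\<close> cancels between
    the endpoints and the midpoint. It forces minimizing sequences to be Cauchy.\<close>
  have par: "(norm (v - w))\<^sup>2 / 4 = E v + E w - 2 * E ((1/2) *\<^sub>R (v + w))" for v w
    unfolding E_def f.scaleR f.add power2_norm_eq_inner
    by (simp add: inner_diff_left inner_diff_right inner_add_left inner_add_right field_simps inner_commute)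
  have dist_le: "(norm (x i - x j))\<^sup>2 \<le> 4 * (1 / Suc i + 1 / Suc j)" for i j
  proof -
    define p q where "p = 1 / real (Suc i)" and "q = 1 / real (Suc j)"
    have "E (x i) < m + p" "E (x j) < m + q" using x by (auto simp: p_def q_def)
    then show ?thesis
      using par[of "x i" "x j"] mle[of "(1/2) *\<^sub>R (x i + x j)"]
      unfolding p_def[symmetric] q_def[symmetric] by argo
  qed
  have "Cauchy x"
  proof (rule metric_CauchyI)
    fix e :: real assume "e > 0"
    then obtain N where N: "1 / Suc N < e\<^sup>2 / 8"
      using nat_approx_posE[of "e\<^sup>2 / 8"] by auto
    have "dist (x i) (x j) < e" if "i \<ge> N" "j \<ge> N" for i j
    proof -
      have "1 / Suc i \<le> 1 / Suc N" "1 / Suc j \<le> 1 / Suc N"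
        using that by (auto intro!: divide_left_mono)
      then have "4 * (1 / Suc i + 1 / Suc j) \<le> 4 * (1 / Suc N + 1 / Suc N)"
        by (intro mult_left_mono add_mono) auto
      also have "\<dots> < e\<^sup>2" using N by simp
      finally have "(norm (x i - x j))\<^sup>2 < e\<^sup>2" using dist_le[of i j] by (rule order.strict_trans1[rotated])
      then show ?thesis using \<open>e > 0\<close> by (simp add: dist_norm power2_less_imp_less)
    qed
    then show "\<exists>N. \<forall>i\<ge>N. \<forall>j\<ge>N. dist (x i) (x j) < e" by blast
  qed
  then obtain w where w: "x \<longlonglongrightarrow> w" using Cauchy_convergent convergent_def by blast
  have "(\<lambda>n. E (x n)) \<longlonglongrightarrow> E w"
    unfolding E_def by (intro tendsto_intros f.tendsto w) simp
  moreover have "(\<lambda>n. m + 1 / Suc n) \<longlonglongrightarrow> m + 0"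
    by (intro tendsto_add tendsto_const LIMSEQ_inverse_real_of_nat[unfolded inverse_eq_divide])
  moreover have "\<exists>N. \<forall>n\<ge>N. E (x n) \<le> m + 1 / Suc n"
    using x less_imp_le by blast
  ultimately have "E w \<le> m + 0"
    by (rule LIMSEQ_le)
  then have min: "E w \<le> E v" for v using mle[of v] by simp
  have "f v = w \<bullet> v" for v
  proof (cases "v = 0")
    case False
    define d where "d = w \<bullet> v - f v"
    define s where "s = (norm v)\<^sup>2"
    have s: "s > 0" using False by (simp add: s_def)
    have "E (w + t *\<^sub>R v) = E w + t * d + t\<^sup>2 * s / 2" for t
      unfolding E_def d_def s_def f.scaleR f.add power2_norm_eq_inner
      by (simp add: inner_add algebra_simps inner_commute power2_eq_square)
    \<comment> \<open>The vertex of the quadratic polynomial in \<open>t\<close>, where its value is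
      lowest.\<close>
    from this[of "- (d / s)"] min[of "w + (- (d / s)) *\<^sub>R v"]
    have "0 \<le> - (d / s) * d + (- (d / s))\<^sup>2 * s / 2" by linarith
    also have "\<dots> = - (d\<^sup>2 / (2 * s))" using s by (simp add: field_simps power2_eq_square)
    finally have "d\<^sup>2 \<le> 0" using s by (simp add: divide_le_0_iff)
    then show ?thesis by (simp add: d_def)
  qed (simp add: f.zero)
  then show ?thesis by (rule that)
qed

section \<open>Weak sequential compactness of bounded sequences\<close>

lemma bounded_real_sequences_diagonal:
  fixes g :: "nat \<Rightarrow> nat \<Rightarrow> real"
  assumes "\<And>k. bounded (range (g k))"
  obtains r :: "nat \<Rightarrow> nat" where "strict_mono r" "\<And>k. convergent (g k \<circ> r)"
proof -
  interpret subseqs "\<lambda>k s. convergent (g k \<circ> s)"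
  proof
    fix k and s :: "nat \<Rightarrow> nat" assume "strict_mono s"
    have "bounded (range (g k \<circ> s))"
      using assms[of k] by (rule bounded_subset) auto
    then obtain l r where "strict_mono r" "((g k \<circ> s) \<circ> r) \<longlonglongrightarrow> l"
      using bounded_imp_convergent_subsequence by blast
    then show "\<exists>r'. strict_mono r' \<and> convergent (g k \<circ> (s \<circ> r'))"
      by (auto simp: convergent_def o_assoc)
  qed
  have "convergent (g k \<circ> diagseq)" for k
  proof -
    \<comment> \<open>Only from index \<open>Suc k\<close> on is the diagonal sequence a subsequence
      of the one refined for \<open>k\<close>; the initial segment is dropped afterwards.\<close>
    have "convergent (g k \<circ> (diagseq \<circ> ((+) (Suc k))))"
    proof (rule diagseq_holds)
      fix x s n assume "strict_mono (x :: nat \<Rightarrow> nat)" "convergent (g n \<circ> s)"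
      then show "convergent (g n \<circ> (s \<circ> x))"
        using convergent_subseq_convergent by (metis o_assoc)
    qed
    then have "convergent (\<lambda>n. (g k \<circ> diagseq) (n + Suc k))"
      by (simp add: o_def add.commute)
    then show ?thesis by (rule convergent_ignore_initial_segment[THEN iffD1])
  qed
  with subseq_diagseq show ?thesis by (rule that)
qed

text \<open>A diagonal argument gives convergence of the inner products with a countable dense set,
  boundedness extends it to all vectors, and the limit functional is represented by a
  vector.\<close>

lemma Hilbert_bounded_weak_subsequence:
  fixes x :: "nat \<Rightarrow> 'a::{real_inner, complete_space}"
  assumes sep: "separable_space (euclidean :: 'a topology)" and bd: "bounded (range x)"
  obtains r w where "strict_mono r" "limitin weak_topology (x \<circ> r) w sequentially"
proof -
  obtain C :: "'a set" where C: "countable C" "closure C = UNIV"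
    using sep by (auto simp: separable_space_def)
  then have "C \<noteq> {}" by auto
  then obtain d :: "nat \<Rightarrow> 'a" where d: "range d = C"
    using C(1) by (metis range_from_nat_into)
  obtain B where B: "B > 0" "\<And>n. norm (x n) \<le> B"
    using bd by (auto simp: bounded_pos)
  have "bounded (range (\<lambda>n. x n \<bullet> d k))" for k
    by (rule boundedI[of _ "B * norm (d k)"])
      (auto intro!: order_trans[OF Cauchy_Schwarz_ineq2] mult_right_mono B)
  then obtain r where r: "strict_mono r" "\<And>k. convergent ((\<lambda>n. x n \<bullet> d k) \<circ> r)"
    using bounded_real_sequences_diagonal[of "\<lambda>k n. x n \<bullet> d k"] by blast
  have conv: "convergent (\<lambda>n. x (r n) \<bullet> v)" for v
  proof (rule Cauchy_convergent, rule metric_CauchyI)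
    fix e :: real assume e: "e > 0"
    have "v \<in> closure C" using C by simp
    then obtain k where k: "dist (d k) v < e / (3 * B)"
      using e B d by (metis closure_approachable divide_pos_pos mult_pos_pos rangeE zero_less_numeral)
    have near: "\<bar>x n \<bullet> v - x n \<bullet> d k\<bar> < e / 3" for n
    proof -
      have "\<bar>x n \<bullet> v - x n \<bullet> d k\<bar> \<le> norm (x n) * norm (v - d k)"
        by (metis Cauchy_Schwarz_ineq2 inner_diff_right)
      also have "\<dots> \<le> B * norm (v - d k)" by (intro mult_right_mono B) auto
      also have "\<dots> < e / 3"
        using k B by (simp add: dist_norm norm_minus_commute field_simps)
      finally show ?thesis .
    qed
    have "Cauchy (\<lambda>n. x (r n) \<bullet> d k)"
      using r(2)[of k] by (simp add: o_def convergent_Cauchy)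
    from metric_CauchyD[OF this, of "e / 3"]
    obtain N where N: "\<And>i j. i \<ge> N \<Longrightarrow> j \<ge> N \<Longrightarrow> \<bar>x (r i) \<bullet> d k - x (r j) \<bullet> d k\<bar> < e / 3"
      using e by (auto simp: dist_real_def)
    show "\<exists>N. \<forall>i\<ge>N. \<forall>j\<ge>N. dist (x (r i) \<bullet> v) (x (r j) \<bullet> v) < e"
    proof (intro exI allI impI)
      fix i j assume "i \<ge> N" "j \<ge> N"
      with N[of i j] near[of "r i"] near[of "r j"] show "dist (x (r i) \<bullet> v) (x (r j) \<bullet> v) < e"
        unfolding dist_real_def by linarith
    qed
  qed
  define L where "L v = lim (\<lambda>n. x (r n) \<bullet> v)" for v
  have L: "(\<lambda>n. x (r n) \<bullet> v) \<longlonglongrightarrow> L v" for v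
    using conv[of v] unfolding L_def by (simp add: convergent_LIMSEQ_iff)
  have "bounded_linear L"
  proof (rule bounded_linear_intro)
    show "L (v + w) = L v + L w" for v w
      using tendsto_add[OF L[of v] L[of w]] L[of "v + w"]
      by (simp add: inner_add LIMSEQ_unique)
    show "L (t *\<^sub>R v) = t *\<^sub>R L v" for t v
      using tendsto_mult_left[OF L[of v], of t] L[of "t *\<^sub>R v"]
      by (simp add: LIMSEQ_unique)
    show "norm (L v) \<le> norm v * B" for v
    proof (rule LIMSEQ_le_const2[OF tendsto_norm[OF L[of v]]])
      have "norm (x (r n) \<bullet> v) \<le> norm v * B" for n
        using Cauchy_Schwarz_ineq2[of "x (r n)" v] mult_right_mono[OF B(2), of "norm v" "r n"]
        by (simp add: mult.commute)
      then show "\<exists>N. \<forall>n\<ge>N. norm (x (r n) \<bullet> v) \<le> norm v * B" by blast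
    qed
  qed
  then obtain w where w: "\<And>v. L v = w \<bullet> v" by (rule Riesz_representation) blast
  have "limitin weak_topology (x \<circ> r) w sequentially"
    unfolding limitin_weak_topology
  proof (intro allI impI)
    fix f :: "'a \<Rightarrow> real" assume "bounded_linear f"
    then obtain y where "\<And>v. f v = y \<bullet> v" by (rule Riesz_representation) blast
    then show "(\<lambda>n. f ((x \<circ> r) n)) \<longlonglongrightarrow> f w"
      using L[of y] by (simp add: w inner_commute)
  qed
  with r(1) show ?thesis by (rule that)
qed

lemma closedin_weak_topology_kernel:
  fixes f :: "'a::real_normed_vector \<Rightarrow> real"
  assumes "bounded_linear f"
  shows "closedin weak_topology {v. f v = 0}"
proof -
  have "openin weak_topology (f -` (- {0}))"
    unfolding weak_topology_def by (rule topology_generated_by_Basis) (use assms in blast)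
  moreover have "UNIV - {v. f v = 0} = f -` (- {0})" by auto
  ultimately show ?thesis by (simp add: closedin_def)
qed

text \<open>The span is the fixed point set of the orthogonal projection \<open>P\<close>, hence an
  intersection of kernels of bounded functionals.\<close>

lemma closedin_weak_topology_span:
  fixes S :: "'a::real_inner set"
  assumes "finite S"
  shows "closedin weak_topology (span S)"
proof -
  obtain C where C: "finite C" "span C = span S" "pairwise orthogonal C"
    using basis_orthogonal[OF assms] by blast
  \<comment> \<open>\<open>C\<close> may contain 0, whose term vanishes whatever the value of its
    coefficient.\<close>
  define P where "P v = (\<Sum>c\<in>C. (v \<bullet> c / (c \<bullet> c)) *\<^sub>R c)" for v
  have P: "bounded_linear P"
    unfolding P_def
    by (intro bounded_linear_sum bounded_linear_scaleR_const
        bounded_linear_compose[OF bounded_linear_divide bounded_linear_inner_left])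
  interpret P: bounded_linear P by fact
  have *: "P c = c" if "c \<in> C" for c
  proof -
    have "P c = (\<Sum>e\<in>C. if e = c then c else 0)"
      unfolding P_def using C(3) that
      by (intro sum.cong refl) (auto simp: pairwise_def orthogonal_def)
    with C(1) that show ?thesis by simp
  qed
  have P_id: "P v = v" if "v \<in> span C" for v
    by (rule span_induct[OF that, of "\<lambda>v. P v = v"])
      (use * in \<open>auto simp: subspace_def P.zero P.add P.scaleR\<close>)
  have P_span: "P v \<in> span C" for v
    unfolding P_def by (intro span_sum span_scale span_base)
  have "span S = {v. P v = v}"
  proof (intro subset_antisym subsetI CollectI)
    show "P v = v" if "v \<in> span S" for v using that P_id C(2) by simp
    show "v \<in> span S" if "v \<in> {v. P v = v}" for v using that P_span[of v] C(2) by simp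
  qed
  also have "\<dots> = (\<Inter>y. {v. (P v - v) \<bullet> y = 0})"
  proof -
    have "P v = v \<longleftrightarrow> (\<forall>y. (P v - v) \<bullet> y = 0)" for v
      by (metis inner_eq_zero_iff inner_zero_left right_minus_eq)
    then show ?thesis by auto
  qed
  also have "closedin weak_topology \<dots>"
  proof (rule closedin_INT)
    fix y
    have "bounded_linear (\<lambda>v. (P v - v) \<bullet> y)"
      by (intro bounded_linear_compose[OF bounded_linear_inner_left] bounded_linear_sub P bounded_linear_ident)
    then show "closedin weak_topology {v. (P v - v) \<bullet> y = 0}"
      by (rule closedin_weak_topology_kernel)
  qed simp
  finally show ?thesis .
qed

text \<open>A sequence that fails to converge to \<open>l\<close> has a subsequence staying a fixed
  distance away. This turns compactness into convergence of whole sequences.\<close>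

lemma LIMSEQ_if_subsequences:
  fixes x :: "nat \<Rightarrow> 'a::metric_space"
  assumes "\<And>r::nat \<Rightarrow> nat. strict_mono r \<Longrightarrow> \<exists>s. strict_mono s \<and> (x \<circ> r \<circ> s) \<longlonglongrightarrow> l"
  shows "x \<longlonglongrightarrow> l"
proof (rule ccontr)
  assume "\<not> x \<longlonglongrightarrow> l"
  then obtain e where e: "e > 0" "\<not> (\<forall>\<^sub>F n in sequentially. dist (x n) l < e)"
    unfolding tendsto_iff by blast
  then have "infinite {n. \<not> dist (x n) l < e}"
    by (simp add: cofinite_eq_sequentially[symmetric] eventually_cofinite)
  then obtain r :: "nat \<Rightarrow> nat" where r: "strict_mono r" "\<And>n. \<not> dist (x (r n)) l < e"
    using infinite_enumerate by blast
  obtain s where "(x \<circ> r \<circ> s) \<longlonglongrightarrow> l" using assms[OF r(1)] by blast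
  then have "\<forall>\<^sub>F n in sequentially. dist (x (r (s n))) l < e"
    using e(1) by (auto simp: tendsto_iff)
  with r(2) show False by simp
qed

section \<open>Compactly embedded coercive forms\<close>

text \<open>For \<open>y \<ge> 1\<close> the constant \<open>C\<close> is absorbed into
  \<open>C * y\<close> and one factor \<open>y\<close> cancels; the summand 1 covers smaller
  \<open>y\<close>. It bounds minimizing sequences.\<close>

lemma quadratic_growth_bound:
  fixes y :: real
  assumes "A > 0" "B \<ge> 0" "C \<ge> 0" "A * y\<^sup>2 \<le> B * y + C"
  shows "y \<le> (B + C) / A + 1"
proof (cases "y \<ge> 1")
  case True
  then have "C \<le> C * y" using assms(3) mult_left_mono[of 1 y C] by simp
  then have "y * (A * y) \<le> y * (B + C)"
    using assms(4) by (simp add: algebra_simps power2_eq_square)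
  then have "A * y \<le> B + C" using True by simp
  then show ?thesis using assms(1) by (simp add: field_simps)
next
  case False
  moreover have "(B + C) / A \<ge> 0" using assms by simp
  ultimately show ?thesis by simp
qed

text \<open>Staying below \<open>c\<close> along the whole sequence, and not just in the limit, is
  what lets each existence proof bound the sequence.\<close>

lemma minimizing_sequence:
  fixes f :: "'a \<Rightarrow> real"
  assumes "bdd_below (f ` P)" "p \<in> P" "f p < c"
  obtains x where "\<And>n. x n \<in> P" "\<And>n. f (x n) < c" "(\<lambda>n. f (x n)) \<longlonglongrightarrow> Inf (f ` P)"
proof -
  define m where "m = Inf (f ` P)"
  have m: "m \<le> f y" if "y \<in> P" for y
    unfolding m_def using that assms(1) by (intro cInf_lower) auto
  have "\<exists>y\<in>P. f y < min c (m + 1 / Suc n)" for n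
  proof -
    have "m < min c (m + 1 / Suc n)" using m[OF assms(2)] assms(3) by simp
    then show ?thesis unfolding m_def using cInf_lessD[of "f ` P"] assms(2) by blast
  qed
  then obtain x where x: "\<And>n. x n \<in> P" "\<And>n. f (x n) < min c (m + 1 / Suc n)" by metis
  have "(\<lambda>n. f (x n)) \<longlonglongrightarrow> m"
  proof (rule tendsto_sandwich[OF _ _ tendsto_const])
    show "\<forall>\<^sub>F n in sequentially. m \<le> f (x n)" using m x(1) by simp
    show "\<forall>\<^sub>F n in sequentially. f (x n) \<le> m + 1 / Suc n"
      using x(2) by (simp add: less_imp_le)
    show "(\<lambda>n. m + 1 / Suc n) \<longlonglongrightarrow> m"
      using tendsto_add[OF tendsto_const LIMSEQ_inverse_real_of_nat[unfolded inverse_eq_divide]]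
      by force
  qed
  with x show ?thesis unfolding m_def by (intro that[of x]) auto
qed

lemma limitin_weak_topology_add:
  assumes "limitin weak_topology x w F"
  shows "limitin weak_topology (\<lambda>n. u + x n) (u + w) F"
  unfolding limitin_weak_topology
proof (intro allI impI)
  fix f :: "'a \<Rightarrow> real" assume f: "bounded_linear f"
  then have "((\<lambda>n. f u + f (x n)) \<longlongrightarrow> f u + f w) F"
    by (intro tendsto_add tendsto_const limitin_weak_topologyD[OF assms])
  then show "((\<lambda>n. f (u + x n)) \<longlongrightarrow> f (u + w)) F"
    by (simp add: linear_add[OF bounded_linear.linear[OF f]])
qed

text \<open>The last assumption is the choice of \<open>\<nu>\<close> made once and for all; it
  gives H-unit vectors an energy of at least 1.\<close>

locale compactly_embedded_form =
  fixes \<iota> :: "'v::{real_inner, complete_space} \<Rightarrow> 'h::{real_inner, complete_space}"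
    and a :: "'v \<Rightarrow> 'v \<Rightarrow> real"
    and \<gamma> \<nu> :: real
  assumes separable: "separable_space (euclidean :: 'v topology)"
    and embedding: "dense_compact_embedding \<iota>"
    and bilinear: "bounded_bilinear a"
    and sym: "a v w = a w v"
    and gamma_pos: "\<gamma> > 0" and nu_pos: "\<nu> > 0"
    and coercive: "\<gamma> * (norm v)\<^sup>2 - \<nu> * (norm (\<iota> v))\<^sup>2 \<le> a v v"
    and norm_le_norm_a: "norm (\<iota> v) \<le> norm_a \<iota> a \<nu> v"
begin

section \<open>Algebra of the form and of the Rayleigh quotient\<close>

sublocale iota: bounded_linear \<iota>
  using embedding by (simp add: dense_compact_embedding_def)

sublocale form: bounded_bilinear a
  by (rule bilinear)

text \<open>The scalar product whose norm is \<open>norm_a\<close>. Unlike \<open>a\<close> it is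
  positive definite, hence weakly lower semicontinuous on the diagonal.\<close>

definition energy :: "'v \<Rightarrow> 'v \<Rightarrow> real" where
  "energy v w = a v w + \<nu> * (\<iota> v \<bullet> \<iota> w)"

text \<open>A real-valued Rayleigh quotient: at 0 it takes the value 0 instead of \<infinity>, so
  minimality statements about it carry an explicit nonzero condition, while
  \<open>form_quotient\<close> holds everywhere.\<close>

definition quotient :: "'v \<Rightarrow> real" where
  "quotient v = a v v / (norm (\<iota> v))\<^sup>2"

lemma iota_eq_0_iff [simp]: "\<iota> v = 0 \<longleftrightarrow> v = 0"
  using embedding iota.zero by (metis dense_compact_embedding_def injD)

lemma energy_self: "energy v v = a v v + \<nu> * (norm (\<iota> v))\<^sup>2"
  by (simp add: energy_def power2_norm_eq_inner)

lemma energy_coercive: "\<gamma> * (norm v)\<^sup>2 \<le> energy v v"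
  using coercive[of v] by (simp add: energy_self)

lemma energy_nonneg: "0 \<le> energy v v"
  using energy_coercive[of v] gamma_pos by (meson mult_nonneg_nonneg less_imp_le order_trans zero_le_power2)

lemma norm_a_energy: "norm_a \<iota> a \<nu> v = sqrt (energy v v)"
  by (simp add: norm_a_def energy_def)

lemma norm_a_square: "(norm_a \<iota> a \<nu> v)\<^sup>2 = energy v v"
  by (simp add: norm_a_energy energy_nonneg)

lemma norm_H_le_energy: "(norm (\<iota> v))\<^sup>2 \<le> energy v v"
  using norm_le_norm_a[of v] by (metis norm_a_square norm_ge_zero power_mono)

lemma energy_sym: "energy v w = energy w v"
  by (simp add: energy_def sym inner_commute)

lemma bounded_linear_H_inner: "bounded_linear (\<lambda>v. \<iota> v \<bullet> h)"
  by (rule bounded_linear_compose[OF bounded_linear_inner_left iota.bounded_linear_axioms])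

lemma bounded_linear_form: "bounded_linear (\<lambda>v. a v w)"
  by (rule form.bounded_linear_left)

lemma bounded_linear_energy: "bounded_linear (\<lambda>v. energy v w)"
  unfolding energy_def
  by (intro bounded_linear_add bounded_linear_form bounded_linear_const_mult bounded_linear_H_inner)

lemmas form_expand = form.add_left form.add_right form.diff_left form.diff_right
  form.scaleR_left form.scaleR_right form.minus_left form.minus_right
  iota.add iota.diff iota.scaleR iota.neg inner_add_left inner_add_right
  inner_diff_left inner_diff_right

lemma energy_diff: "energy (v - w) (v - w) = energy v v - 2 * energy v w + energy w w"
  by (simp add: energy_def form_expand sym[of w v] inner_commute[of "\<iota> w" "\<iota> v"] algebra_simps)

lemma form_quotient: "a v v = quotient v * (norm (\<iota> v))\<^sup>2"
  by (cases "v = 0") (simp_all add: quotient_def form.zero_left)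

lemma quotient_lower: "- \<nu> \<le> quotient v"
proof (cases "v = 0")
  case False
  have "0 \<le> (quotient v + \<nu>) * (norm (\<iota> v))\<^sup>2"
    using energy_nonneg[of v] by (simp add: energy_self form_quotient algebra_simps)
  then show ?thesis using False by (simp add: zero_le_mult_iff)
qed (use nu_pos in \<open>simp add: quotient_def\<close>)

lemma quotient_scaleR: "t \<noteq> 0 \<Longrightarrow> quotient (t *\<^sub>R v) = quotient v"
  by (simp add: quotient_def form_expand power_mult_distrib) (simp add: power2_eq_square)

lemma rayleigh_quotient: "rayleigh \<iota> a v = (if v = 0 then \<infinity> else ereal (quotient v))"
  by (simp add: rayleigh_def quotient_def)

text \<open>Compactness yields strongly convergent subsequences in H. Their limits are identified by
  testing against \<open>h\<close>, because \<open>\<iota> v \<bullet> h\<close> is a bounded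
  functional of \<open>v\<close> on V.\<close>

lemma weak_imp_H_strong:
  assumes "limitin weak_topology x w sequentially" "bounded (range x)"
  shows "(\<lambda>n. \<iota> (x n)) \<longlonglongrightarrow> \<iota> w"
proof (rule LIMSEQ_if_subsequences)
  fix r :: "nat \<Rightarrow> nat" assume r: "strict_mono r"
  have "compact (closure (\<iota> ` range x))"
    using embedding assms(2) by (simp add: dense_compact_embedding_def)
  moreover have "\<forall>n. ((\<lambda>n. \<iota> (x n)) \<circ> r) n \<in> closure (\<iota> ` range x)"
    using closure_subset[of "\<iota> ` range x"] by auto
  ultimately obtain l s where s: "strict_mono s" "((\<lambda>n. \<iota> (x n)) \<circ> r \<circ> s) \<longlonglongrightarrow> l"
    unfolding compact_def by metis
  have "l \<bullet> h = \<iota> w \<bullet> h" for h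
  proof (rule LIMSEQ_unique)
    show "(\<lambda>n. \<iota> (x (r (s n))) \<bullet> h) \<longlonglongrightarrow> l \<bullet> h"
      using tendsto_inner[OF s(2) tendsto_const[of h]] by (simp add: o_def)
    have "((\<lambda>n. \<iota> (x n) \<bullet> h) \<circ> (r \<circ> s)) \<longlonglongrightarrow> \<iota> w \<bullet> h"
      by (intro LIMSEQ_subseq_LIMSEQ limitin_weak_topologyD[OF assms(1) bounded_linear_H_inner]
          strict_mono_o r s)
    then show "(\<lambda>n. \<iota> (x (r (s n))) \<bullet> h) \<longlonglongrightarrow> \<iota> w \<bullet> h" by (simp add: o_def)
  qed
  then have "l = \<iota> w" using vector_eq_rdot by blast
  with s show "\<exists>s. strict_mono s \<and> ((\<lambda>n. \<iota> (x n)) \<circ> r \<circ> s) \<longlonglongrightarrow> \<iota> w" by blast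
qed

text \<open>The form \<open>a\<close> may be indefinite. The energy is convex, hence lies above its
  tangent at \<open>w\<close>, which is weakly continuous, and the H-part separating the two
  converges by compactness.\<close>

lemma form_weak_lower_semicontinuous:
  assumes "limitin weak_topology x w sequentially" "bounded (range x)"
    and "(\<lambda>n. a (x n) (x n)) \<longlonglongrightarrow> L"
  shows "a w w \<le> L"
proof -
  have "(\<lambda>n. energy (x n) (x n)) \<longlonglongrightarrow> L + \<nu> * (norm (\<iota> w))\<^sup>2"
    unfolding energy_self by (intro tendsto_intros assms weak_imp_H_strong)
  moreover have "(\<lambda>n. 2 * energy (x n) w - energy w w) \<longlonglongrightarrow> 2 * energy w w - energy w w"
    by (intro tendsto_intros limitin_weak_topologyD[OF assms(1) bounded_linear_energy])
  moreover have "2 * energy (x n) w - energy w w \<le> energy (x n) (x n)" for n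
    using energy_nonneg[of "x n - w"] by (simp add: energy_diff)
  ultimately have "2 * energy w w - energy w w \<le> L + \<nu> * (norm (\<iota> w))\<^sup>2"
    by (intro LIMSEQ_le) auto
  then show ?thesis by (simp add: energy_self)
qed

lemma quotient_weak_lower_semicontinuous:
  assumes "limitin weak_topology x w sequentially" "bounded (range x)"
    and "(\<lambda>n. quotient (x n)) \<longlonglongrightarrow> m" "w \<noteq> 0"
  shows "quotient w \<le> m"
proof -
  have "(\<lambda>n. quotient (x n) * (norm (\<iota> (x n)))\<^sup>2) \<longlonglongrightarrow> m * (norm (\<iota> w))\<^sup>2"
    by (intro tendsto_intros assms weak_imp_H_strong)
  then have "a w w \<le> m * (norm (\<iota> w))\<^sup>2"
    unfolding form_quotient[symmetric] by (rule form_weak_lower_semicontinuous[OF assms(1,2)])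
  then show ?thesis using assms(4) by (simp add: quotient_def divide_le_eq)
qed

section \<open>Existence of minimizers by the direct method\<close>

lemma weakly_closed_subsequence:
  fixes x :: "nat \<Rightarrow> 'v"
  assumes "bounded (range x)" "closedin weak_topology K" "\<And>n. x n \<in> K"
  obtains r w where "strict_mono r" "w \<in> K" "limitin weak_topology (x \<circ> r) w sequentially"
proof -
  obtain r w where r: "strict_mono r" "limitin weak_topology (x \<circ> r) w sequentially"
    using Hilbert_bounded_weak_subsequence[OF separable assms(1)] .
  have "w \<in> K"
    by (rule limitin_closedin[OF r(2) assms(2)]) (use assms(3) in auto)
  with r show ?thesis using that by blast
qed

text \<open>By homogeneity it suffices to minimize over H-unit vectors. Coercivity bounds a
  minimizing sequence, and the normalization survives the weak limit because the embedding is
  compact.\<close>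

lemma ex_minimizer_quotient_span:
  assumes "finite S" "v \<in> span S" "v \<noteq> 0"
  shows "\<exists>w\<in>span S. w \<noteq> 0 \<and> (\<forall>y\<in>span S. y \<noteq> 0 \<longrightarrow> quotient w \<le> quotient y)"
proof -
  define P where "P = {y \<in> span S. norm (\<iota> y) = 1}"
  define normalize where "normalize y = y /\<^sub>R norm (\<iota> y)" for y
  have normalize: "normalize y \<in> P" "quotient (normalize y) = quotient y"
    if "y \<in> span S" "y \<noteq> 0" for y
    using that unfolding P_def normalize_def
    by (auto simp: span_scale iota.scaleR quotient_scaleR)
  have bdd: "bdd_below (quotient ` P)"
    using quotient_lower by (auto intro!: bdd_belowI2)
  obtain x where x: "\<And>n. x n \<in> P" "\<And>n. quotient (x n) < quotient v + 1"
      "(\<lambda>n. quotient (x n)) \<longlonglongrightarrow> Inf (quotient ` P)"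
    using minimizing_sequence[OF bdd, of "normalize v" "quotient v + 1"]
      normalize[OF assms(2,3)] by auto
  have "(norm (x n))\<^sup>2 \<le> (quotient v + 1 + \<nu>) / \<gamma>" for n
  proof -
    have "\<gamma> * (norm (x n))\<^sup>2 \<le> quotient (x n) + \<nu>"
      using energy_coercive[of "x n"] x(1)[of n] by (simp add: energy_self form_quotient P_def)
    then show ?thesis using x(2)[of n] gamma_pos by (simp add: pos_le_divide_eq mult.commute)
  qed
  then have "norm (x n) \<le> sqrt ((quotient v + 1 + \<nu>) / \<gamma>)" for n
    by (simp add: real_le_rsqrt)
  then have bd: "bounded (range x)" by (auto intro!: boundedI)
  then obtain r w where r: "strict_mono r" "w \<in> span S"
      "limitin weak_topology (x \<circ> r) w sequentially"
    using weakly_closed_subsequence[OF _ closedin_weak_topology_span[OF assms(1)]] x(1)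
    by (metis (no_types, lifting) P_def mem_Collect_eq)
  have bdr: "bounded (range (x \<circ> r))" by (rule bounded_subset[OF bd]) auto
  have "(\<lambda>n. norm (\<iota> ((x \<circ> r) n))) \<longlonglongrightarrow> norm (\<iota> w)"
    by (intro tendsto_norm weak_imp_H_strong r bdr)
  then have "norm (\<iota> w) = 1"
    using x(1) by (simp add: P_def LIMSEQ_const_iff)
  then have w: "w \<noteq> 0" by auto
  have "quotient w \<le> Inf (quotient ` P)"
    using LIMSEQ_subseq_LIMSEQ[OF x(3) r(1)]
    by (intro quotient_weak_lower_semicontinuous[OF r(3) bdr _ w]) (simp add: o_def)
  moreover have "Inf (quotient ` P) \<le> quotient y" if "y \<in> span S" "y \<noteq> 0" for y
    using cInf_lower[OF _ bdd] normalize[OF that] by (metis imageI)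
  ultimately show ?thesis using r(2) w by (meson order_trans)
qed

text \<open>As \<open>t\<close> grows, the quotient of \<open>u + t *\<^sub>R z\<close> tends to
  that of a nonzero \<open>z\<close>, so minimizers may be lost at infinity; they may also be lost
  in a limit with \<open>u + z = 0\<close>. The lower bound \<open>l\<close> on \<open>K\<close>,
  strictly above \<open>a u u\<close>, excludes both.\<close>

lemma ex_minimizer_quotient_translate:
  assumes K: "closedin weak_topology K" "0 \<in> K" and u: "norm (\<iota> u) = 1" "a u u < l"
    and l: "\<And>z. z \<in> K \<Longrightarrow> l * (norm (\<iota> z))\<^sup>2 \<le> a z z"
  shows "\<exists>z\<in>K. u + z \<noteq> 0 \<and> (\<forall>y\<in>K. u + y \<noteq> 0 \<longrightarrow> quotient (u + z) \<le> quotient (u + y))"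
proof -
  define P where "P = {z \<in> K. u + z \<noteq> 0}"
  define f where "f z = quotient (u + z)" for z
  \<comment> \<open>Any value strictly inside the gap would do: \<open>0\<close> is then a
    competitor below \<open>c\<close>, and the distance from \<open>c\<close> to \<open>l\<close>
    stays fixed.\<close>
  define c where "c = (a u u + l) / 2"
  have u0: "u \<noteq> 0" using u(1) by auto
  have qu: "quotient u = a u u" using u by (simp add: quotient_def)
  have "a u u < c" "c < l" using u(2) by (auto simp: c_def)
  moreover from this have "c + \<nu> > 0" using quotient_lower[of u] qu by linarith
  ultimately have c: "a u u < c" "c < l" "c + \<nu> > 0" .
  have bdd: "bdd_below (f ` P)" unfolding f_def using quotient_lower by (auto intro!: bdd_belowI2)
  have "0 \<in> P" "f 0 < c" using K u0 c by (auto simp: P_def f_def qu)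
  then obtain x where x: "\<And>n. x n \<in> P" "\<And>n. f (x n) < c" "(\<lambda>n. f (x n)) \<longlonglongrightarrow> Inf (f ` P)"
    using minimizing_sequence[OF bdd] by blast
  obtain k where k: "k \<ge> 0" "\<And>v w. \<bar>a v w\<bar> \<le> norm v * norm w * k"
    using form.nonneg_bounded by auto
  obtain i where i: "i \<ge> 0" "\<And>v. norm (\<iota> v) \<le> norm v * i"
    using iota.nonneg_bounded by auto
  define B where "B = 2 * (norm u * k) + 2 * (\<bar>l\<bar> * i)"
  define C where "C = \<bar>a u u\<bar> + \<bar>l\<bar>"
  have BC: "B \<ge> 0" "C \<ge> 0" using k i by (auto simp: B_def C_def)
  \<comment> \<open>The gap between c and l is what keeps the minimizing sequence bounded.\<close>
  have "norm (u + x n) \<le> ((c + \<nu>) * B + (c + \<nu>) * C) / (\<gamma> * (l - c)) + 1" for n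
  proof (rule quadratic_growth_bound)
    define w where "w = u + x n"
    have aw: "a w w \<le> c * (norm (\<iota> w))\<^sup>2"
      unfolding form_quotient using x(2)[of n] by (intro mult_right_mono) (auto simp: f_def w_def)
    have "x n \<in> K" using x(1) by (simp add: P_def)
    moreover have "x n = w - u" by (simp add: w_def)
    ultimately have "l * (norm (\<iota> (w - u)))\<^sup>2 \<le> a (w - u) (w - u)" using l by simp
    also have "a (w - u) (w - u) = a w w - 2 * a w u + a u u"
      by (simp add: form_expand sym[of u w])
    finally have "l * ((norm (\<iota> w))\<^sup>2 - 2 * (\<iota> w \<bullet> \<iota> u) + 1) \<le> a w w - 2 * a w u + a u u"
      using u(1) unfolding power2_norm_eq_inner norm_eq_1
      by (simp add: form_expand inner_commute algebra_simps)
    \<comment> \<open>The lower bound \<open>l\<close> for \<open>w - u\<close> meets the upper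
      bound \<open>c\<close> for \<open>w\<close>: the quadratic H-terms combine with factor
      \<open>l - c\<close>, and what remains grows linearly in \<open>w\<close>.\<close>
    with aw have "(l - c) * (norm (\<iota> w))\<^sup>2 \<le> 2 * (l * (\<iota> w \<bullet> \<iota> u)) - 2 * a w u + a u u - l"
      by (simp add: algebra_simps)
    also have "\<dots> \<le> 2 * (\<bar>l\<bar> * (norm w * i)) + 2 * (norm w * norm u * k) + \<bar>a u u\<bar> + \<bar>l\<bar>"
    proof -
      have "\<bar>\<iota> w \<bullet> \<iota> u\<bar> \<le> norm w * i"
        using Cauchy_Schwarz_ineq2[of "\<iota> w" "\<iota> u"] u(1) i(2)[of w] by simp
      then have "\<bar>l * (\<iota> w \<bullet> \<iota> u)\<bar> \<le> \<bar>l\<bar> * (norm w * i)"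
        unfolding abs_mult by (rule mult_left_mono) simp
      then show ?thesis using k(2)[of w u] by linarith
    qed
    also have "\<dots> = B * norm w + C" by (simp add: B_def C_def algebra_simps)
    finally have H: "(l - c) * (norm (\<iota> w))\<^sup>2 \<le> B * norm w + C" .
    have "\<gamma> * (norm w)\<^sup>2 \<le> (c + \<nu>) * (norm (\<iota> w))\<^sup>2"
      using energy_coercive[of w] aw by (simp add: energy_self algebra_simps)
    then have "(l - c) * (\<gamma> * (norm w)\<^sup>2) \<le> (l - c) * ((c + \<nu>) * (norm (\<iota> w))\<^sup>2)"
      using c by (intro mult_left_mono) auto
    also have "\<dots> = (c + \<nu>) * ((l - c) * (norm (\<iota> w))\<^sup>2)" by simp
    also have "\<dots> \<le> (c + \<nu>) * (B * norm w + C)" using H c by (intro mult_left_mono) auto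
    finally show "\<gamma> * (l - c) * (norm (u + x n))\<^sup>2 \<le> (c + \<nu>) * B * norm (u + x n) + (c + \<nu>) * C"
      by (simp add: w_def algebra_simps)
  qed (use BC c gamma_pos in auto)
  then have bdw: "bounded (range (\<lambda>n. u + x n))" by (auto intro!: boundedI)
  then have "bounded ((+) (- u) ` range (\<lambda>n. u + x n))" by (rule bounded_translation)
  then have bd: "bounded (range x)" by (simp add: image_image)
  then obtain r z where r: "strict_mono r" "z \<in> K" "limitin weak_topology (x \<circ> r) z sequentially"
    using weakly_closed_subsequence[OF _ K(1)] x(1)
    by (metis (no_types, lifting) P_def mem_Collect_eq)
  have "u + z \<noteq> 0"
  proof
    assume "u + z = 0"
    then have "z = - u" by (simp add: eq_neg_iff_add_eq_0 add.commute)
    then show False using l[OF r(2)] u by (simp add: form_expand)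
  qed
  have "f z \<le> Inf (f ` P)" unfolding f_def
  proof (rule quotient_weak_lower_semicontinuous[OF _ _ _ \<open>u + z \<noteq> 0\<close>])
    show "limitin weak_topology (\<lambda>n. u + (x \<circ> r) n) (u + z) sequentially"
      by (rule limitin_weak_topology_add[OF r(3)])
    show "bounded (range (\<lambda>n. u + (x \<circ> r) n))"
      by (rule bounded_subset[OF bdw]) auto
    show "(\<lambda>n. quotient (u + (x \<circ> r) n)) \<longlonglongrightarrow> Inf ((\<lambda>z. quotient (u + z)) ` P)"
      using LIMSEQ_subseq_LIMSEQ[OF x(3) r(1)] by (simp add: f_def o_def)
  qed
  moreover have "Inf (f ` P) \<le> f y" if "y \<in> K" "u + y \<noteq> 0" for y
    by (rule cInf_lower[OF _ bdd]) (use that in \<open>auto simp: P_def\<close>)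
  ultimately show ?thesis using r(2) \<open>u + z \<noteq> 0\<close> by (metis f_def order_trans)
qed

definition residual_objective :: "'v \<Rightarrow> real \<Rightarrow> 'v \<Rightarrow> real" where
  "residual_objective u lam z = energy (u + z) (u + z) / 2 - (lam + \<nu>) * (\<iota> u \<bullet> \<iota> z)"

text \<open>Coercivity of the energy dominates the linear term, so minimizing sequences are bounded
  without any gap assumption.\<close>

lemma ex_minimizer_residual_objective:
  assumes K: "closedin weak_topology K" "0 \<in> K"
  shows "\<exists>z\<in>K. \<forall>y\<in>K. residual_objective u lam z \<le> residual_objective u lam y"
proof -
  define G where "G = residual_objective u lam"
  obtain i where i: "i \<ge> 0" "\<And>v. norm (\<iota> v) \<le> norm v * i"
    using iota.nonneg_bounded by auto
  define B where "B = \<bar>lam + \<nu>\<bar> * (norm (\<iota> u) * i)"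
  define C where "C = \<bar>(lam + \<nu>) * (\<iota> u \<bullet> \<iota> u)\<bar>"
  have BC: "B \<ge> 0" "C \<ge> 0" using i by (auto simp: B_def C_def)
  have low: "(\<gamma> / 2) * (norm (u + z))\<^sup>2 - B * norm (u + z) - C \<le> G z" for z
  proof -
    have "\<bar>\<iota> u \<bullet> \<iota> (u + z)\<bar> \<le> norm (\<iota> u) * norm (\<iota> (u + z))" by (rule Cauchy_Schwarz_ineq2)
    also have "\<dots> \<le> norm (\<iota> u) * (norm (u + z) * i)" by (intro mult_left_mono i) auto
    finally have "\<bar>lam + \<nu>\<bar> * \<bar>\<iota> u \<bullet> \<iota> (u + z)\<bar> \<le> \<bar>lam + \<nu>\<bar> * (norm (\<iota> u) * (norm (u + z) * i))"
      by (rule mult_left_mono) simp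
    then have "(lam + \<nu>) * (\<iota> u \<bullet> \<iota> (u + z)) \<le> B * norm (u + z)"
      unfolding abs_mult[symmetric] B_def by (simp add: mult_ac)
    moreover have "(lam + \<nu>) * (\<iota> u \<bullet> \<iota> z) = (lam + \<nu>) * (\<iota> u \<bullet> \<iota> (u + z)) - (lam + \<nu>) * (\<iota> u \<bullet> \<iota> u)"
      by (simp add: form_expand algebra_simps)
    moreover have "- C \<le> (lam + \<nu>) * (\<iota> u \<bullet> \<iota> u)" unfolding C_def by linarith
    ultimately show ?thesis
      using energy_coercive[of "u + z"] unfolding G_def residual_objective_def by linarith
  qed
  have "- (B\<^sup>2 / (2 * \<gamma>)) - C \<le> G z" for z
  proof -
    have "0 \<le> (\<gamma> * norm (u + z) - B)\<^sup>2 / (2 * \<gamma>)" using gamma_pos by simp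
    also have "\<dots> = (\<gamma> / 2) * (norm (u + z))\<^sup>2 - B * norm (u + z) + B\<^sup>2 / (2 * \<gamma>)"
      using gamma_pos by (simp add: power2_eq_square field_simps)
    finally show ?thesis using low[of z] by linarith
  qed
  then have bdd: "bdd_below (G ` K)" by (auto intro!: bdd_belowI2)
  obtain x where x: "\<And>n. x n \<in> K" "\<And>n. G (x n) < G 0 + 1" "(\<lambda>n. G (x n)) \<longlonglongrightarrow> Inf (G ` K)"
    using minimizing_sequence[OF bdd K(2), of "G 0 + 1"] by auto
  have "norm (u + x n) \<le> (B + (C + \<bar>G 0 + 1\<bar>)) / (\<gamma> / 2) + 1" for n
  proof (rule quadratic_growth_bound)
    show "\<gamma> / 2 * (norm (u + x n))\<^sup>2 \<le> B * norm (u + x n) + (C + \<bar>G 0 + 1\<bar>)"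
      using low[of "x n"] x(2)[of n] by linarith
  qed (use BC gamma_pos in auto)
  then have bdw: "bounded (range (\<lambda>n. u + x n))" by (auto intro!: boundedI)
  then have "bounded ((+) (- u) ` range (\<lambda>n. u + x n))" by (rule bounded_translation)
  then have bd: "bounded (range x)" by (simp add: image_image)
  then obtain r z where r: "strict_mono r" "z \<in> K" "limitin weak_topology (x \<circ> r) z sequentially"
    using weakly_closed_subsequence[OF _ K(1)] x(1) by metis
  define y where "y n = x (r n)" for n
  have y: "limitin weak_topology (\<lambda>n. u + y n) (u + z) sequentially"
    using limitin_weak_topology_add[OF r(3)] by (simp add: y_def o_def)
  have bdy: "bounded (range (\<lambda>n. u + y n))"
    by (rule bounded_subset[OF bdw]) (auto simp: y_def)
  have Gy: "(\<lambda>n. G (y n)) \<longlonglongrightarrow> Inf (G ` K)"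
    using LIMSEQ_subseq_LIMSEQ[OF x(3) r(1)] by (simp add: y_def o_def)
  have uy: "(\<lambda>n. \<iota> u \<bullet> \<iota> (y n)) \<longlonglongrightarrow> \<iota> u \<bullet> \<iota> z"
    using limitin_weak_topologyD[OF r(3) bounded_linear_H_inner[of "\<iota> u"]]
    by (simp add: y_def o_def inner_commute)
  \<comment> \<open>Solving the objective for \<open>a (u + y n) (u + y n)\<close> exhibits the form
    values as a convergent sequence, so that semicontinuity of the form applies.\<close>
  have "(\<lambda>n. 2 * (G (y n) + (lam + \<nu>) * (\<iota> u \<bullet> \<iota> (y n))) - \<nu> * (norm (\<iota> (u + y n)))\<^sup>2)
      \<longlonglongrightarrow> 2 * (Inf (G ` K) + (lam + \<nu>) * (\<iota> u \<bullet> \<iota> z)) - \<nu> * (norm (\<iota> (u + z)))\<^sup>2"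
    by (intro tendsto_diff tendsto_mult tendsto_add tendsto_const tendsto_power tendsto_norm
        uy Gy weak_imp_H_strong[OF y bdy])
  moreover have "2 * (G v + (lam + \<nu>) * (\<iota> u \<bullet> \<iota> v)) - \<nu> * (norm (\<iota> (u + v)))\<^sup>2 = a (u + v) (u + v)" for v
    by (simp add: G_def residual_objective_def energy_self field_simps)
  ultimately have "a (u + z) (u + z)
      \<le> 2 * (Inf (G ` K) + (lam + \<nu>) * (\<iota> u \<bullet> \<iota> z)) - \<nu> * (norm (\<iota> (u + z)))\<^sup>2"
    by (intro form_weak_lower_semicontinuous[OF y bdy]) simp
  then have "G z \<le> Inf (G ` K)"
    unfolding G_def residual_objective_def energy_self by (simp add: field_simps)
  moreover have "Inf (G ` K) \<le> G v" if "v \<in> K" for v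
    by (rule cInf_lower[OF _ bdd]) (use that in auto)
  ultimately show ?thesis using r(2) unfolding G_def by (meson order_trans)
qed

end

section \<open>Vanishing residuals\<close>

text \<open>Evaluation at the vertex gives the bound; a polynomial without quadratic term is
  nonnegative only if its linear term vanishes too.\<close>

lemma nonneg_quadratic_discriminant:
  fixes q r d :: real
  assumes "\<And>t. 0 \<le> t\<^sup>2 * q + 2 * t * r + d" "q \<ge> 0"
  shows "r\<^sup>2 \<le> d * q"
proof (cases "q = 0")
  case True
  have "r = 0"
  proof (rule ccontr)
    assume "r \<noteq> 0"
    \<comment> \<open>At this argument the polynomial has the value -1.\<close>
    then show False using assms(1)[of "- ((d + 1) / (2 * r))"] True by simp
  qed
  then show ?thesis using True by simp
next
  case False
  then have "q > 0" using assms(2) by simp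
  have "0 \<le> q * ((- (r / q))\<^sup>2 * q + 2 * (- (r / q)) * r + d)"
    by (intro mult_nonneg_nonneg assms)
  also have "\<dots> = d * q - r\<^sup>2" using \<open>q > 0\<close> by (simp add: field_simps power2_eq_square)
  finally show ?thesis by simp
qed

lemma lin_comb_in_span: "lin_comb v z n c \<in> span (insert v (z ` {1..n}))"
  unfolding lin_comb_def by (intro span_add span_scale span_sum span_base) auto

lemma span_lin_comb:
  assumes "x \<in> span (insert v (z ` {1..n}))"
  obtains c where "c \<in> {..n} \<rightarrow>\<^sub>E UNIV" "lin_comb v z n c = x"
proof -
  have "subspace (range (lin_comb v z n))"
  proof (rule subspaceI)
    show "0 \<in> range (lin_comb v z n)"
      by (rule range_eqI[of _ _ "\<lambda>_. 0"]) (simp add: lin_comb_def)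
  next
    fix x y assume "x \<in> range (lin_comb v z n)" "y \<in> range (lin_comb v z n)"
    then obtain c d where "x = lin_comb v z n c" "y = lin_comb v z n d" by blast
    then show "x + y \<in> range (lin_comb v z n)"
      by (intro range_eqI[of _ _ "\<lambda>i. c i + d i"])
        (simp add: lin_comb_def scaleR_add_left sum.distrib)
  next
    fix t x assume "x \<in> range (lin_comb v z n)"
    then obtain c where "x = lin_comb v z n c" by blast
    then show "t *\<^sub>R x \<in> range (lin_comb v z n)"
      by (intro range_eqI[of _ _ "\<lambda>i. t * c i"])
        (simp add: lin_comb_def scaleR_add_right scaleR_sum_right)
  qed
  moreover have "insert v (z ` {1..n}) \<subseteq> range (lin_comb v z n)"
  proof
    fix x assume "x \<in> insert v (z ` {1..n})"
    then consider "x = v" | k where "k \<in> {1..n}" "x = z k" by blast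
    then show "x \<in> range (lin_comb v z n)"
    proof cases
      case 1
      then show ?thesis
        by (intro range_eqI[of _ _ "\<lambda>i. if i = 0 then 1 else 0"]) (simp add: lin_comb_def)
    next
      case 2
      have "(\<Sum>i=1..n. (if i = k then 1 else 0) *\<^sub>R z i) = (\<Sum>i=1..n. if i = k then z k else 0)"
        by (intro sum.cong) auto
      then show ?thesis using 2
        by (intro range_eqI[of _ _ "\<lambda>i. if i = k then 1 else 0"]) (simp add: lin_comb_def)
    qed
  qed
  ultimately have "x \<in> range (lin_comb v z n)" using assms span_minimal by blast
  then obtain c where "x = lin_comb v z n c" by blast
  \<comment> \<open>Entries beyond \<open>n\<close> do not matter, so the coefficients can be made
    extensional, as \<open>coeff_argmin\<close> requires.\<close>
  moreover have "lin_comb v z n (restrict c {..n}) = lin_comb v z n c"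
    unfolding lin_comb_def by (intro arg_cong2[of _ _ _ _ "(+)"] sum.cong) auto
  ultimately show ?thesis by (intro that[of "restrict c {..n}"]) auto
qed

text \<open>Linearity carries the limit from \<open>S\<close> to its span, and the bound uniform in
  \<open>n\<close> carries it to the closure.\<close>

lemma closure_induct_tendsto_0:
  fixes f :: "nat \<Rightarrow> 'a::real_normed_vector \<Rightarrow> real"
  assumes "\<And>n. linear (f n)" "\<And>n v. \<bar>f n v\<bar> \<le> C * norm v"
    and "\<And>v. v \<in> S \<Longrightarrow> (\<lambda>n. f n v) \<longlonglongrightarrow> 0" "v \<in> closure (span S)"
  shows "(\<lambda>n. f n v) \<longlonglongrightarrow> 0"
proof (rule LIMSEQ_I)
  have span: "(\<lambda>n. f n y) \<longlonglongrightarrow> 0" if "y \<in> span S" for y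
  proof (rule span_induct[OF that])
    show "subspace {y. (\<lambda>n. f n y) \<longlonglongrightarrow> 0}"
    proof (rule subspaceI)
      fix x y t assume "x \<in> {y. (\<lambda>n. f n y) \<longlonglongrightarrow> 0}"
      then show "t *\<^sub>R x \<in> {y. (\<lambda>n. f n y) \<longlonglongrightarrow> 0}"
        using tendsto_mult_left[of "\<lambda>n. f n x" 0 sequentially t]
        by (simp add: linear_cmul[OF assms(1)])
    next
      fix x y assume "x \<in> {y. (\<lambda>n. f n y) \<longlonglongrightarrow> 0}" "y \<in> {y. (\<lambda>n. f n y) \<longlonglongrightarrow> 0}"
      then show "x + y \<in> {y. (\<lambda>n. f n y) \<longlonglongrightarrow> 0}"
        using tendsto_add[of "\<lambda>n. f n x" 0 sequentially "\<lambda>n. f n y" 0]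
        by (simp add: linear_add[OF assms(1)])
    qed (simp add: linear_0[OF assms(1)])
  qed (rule assms(3))
  fix e :: real assume e: "e > 0"
  \<comment> \<open>Unlike \<open>C\<close>, this constant is certainly positive and may be divided
    by.\<close>
  define K where "K = \<bar>C\<bar> + 1"
  have K: "K > 0" "C \<le> K" by (auto simp: K_def)
  have "0 < e / (2 * K)" using e K by simp
  then obtain y where y: "y \<in> span S" "norm (y - v) < e / (2 * K)"
    using assms(4) unfolding closure_approachable dist_norm by blast
  obtain N where N: "\<And>n. n \<ge> N \<Longrightarrow> \<bar>f n y\<bar> < e / 2"
    using LIMSEQ_D[OF span[OF y(1)], of "e / 2"] e by auto
  show "\<exists>N. \<forall>n\<ge>N. norm (f n v - 0) < e"
  proof (intro exI allI impI)
    fix n assume n: "n \<ge> N"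
    have "\<bar>f n y - f n v\<bar> \<le> C * norm (y - v)"
      using assms(2)[of n "y - v"] by (simp add: linear_diff[OF assms(1)])
    also have "\<dots> \<le> K * norm (y - v)" by (intro mult_right_mono K) auto
    also have "\<dots> < e / 2" using y(2) K by (simp add: field_simps)
    finally show "norm (f n v - 0) < e" using N[OF n] by (simp add: abs_if split: if_splits)
  qed
qed

context compactly_embedded_form
begin

text \<open>For \<open>u \<noteq> 0\<close> this functional of \<open>v\<close> is zero exactly when
  \<open>u\<close> is an eigenvector for \<open>lam\<close>.\<close>

definition residual :: "'v \<Rightarrow> real \<Rightarrow> 'v \<Rightarrow> real" where
  "residual u lam v = a u v - lam * (\<iota> u \<bullet> \<iota> v)"

lemma linear_residual: "linear (residual u lam)"
  by (rule linearI) (simp_all add: residual_def form_expand algebra_simps)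

lemma simple_eigenvalue_normalized_eigenvectors:
  assumes "is_simple_eigenvalue \<iota> a \<mu>" "v \<in> normalized_eigenvectors \<iota> a \<mu>"
    "w \<in> normalized_eigenvectors \<iota> a \<mu>"
  shows "w = v \<or> w = - v"
proof -
  define E where "E = insert 0 {\<psi>. is_eigenvector \<iota> a \<mu> \<psi>}"
  \<comment> \<open>The value 1 rules out the default 0 of \<open>dim\<close>, so a basis exists and
    the one chosen by \<open>dim\<close> is a singleton.\<close>
  have "dim E = 1" using assms(1) by (simp add: is_simple_eigenvalue_def E_def)
  then have ex: "\<exists>b. independent b \<and> span b = span E"
    by (auto simp: dim_def split: if_splits)
  obtain b where b: "span b = span E" "card b = 1"
    using someI_ex[OF ex] ex \<open>dim E = 1\<close> unfolding dim_def by auto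
  then obtain x where "b = {x}" by (auto simp: card_1_singleton_iff)
  then have E: "E \<subseteq> span {x}" using b(1) span_superset by metis
  have *: "v \<in> E" "w \<in> E" "norm (\<iota> v) = 1" "norm (\<iota> w) = 1"
    using assms(2,3) by (auto simp: normalized_eigenvectors_def E_def)
  then obtain s t where st: "v = s *\<^sub>R x" "w = t *\<^sub>R x"
    using E unfolding span_singleton by blast
  have "\<bar>s\<bar> * norm (\<iota> x) = \<bar>t\<bar> * norm (\<iota> x)" "\<bar>s\<bar> * norm (\<iota> x) = 1"
    using *(3,4) by (simp_all add: st iota.scaleR)
  then have "\<bar>s\<bar> = \<bar>t\<bar>" by (metis mult_cancel_right mult_zero_right zero_neq_one)
  then show ?thesis by (auto simp: st abs_eq_iff)
qed

lemma norm_le_energy: "norm v \<le> sqrt (energy v v / \<gamma>)"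
  using energy_coercive[of v] gamma_pos
  by (intro real_le_rsqrt) (simp add: pos_le_divide_eq mult.commute)

lemma strong_if_norm_a:
  assumes "(\<lambda>n. norm_a \<iota> a \<nu> (x n - w)) \<longlonglongrightarrow> 0"
  shows "x \<longlonglongrightarrow> w"
proof -
  have "(\<lambda>n. sqrt ((norm_a \<iota> a \<nu> (x n - w))\<^sup>2 / \<gamma>)) \<longlonglongrightarrow> sqrt (0\<^sup>2 / \<gamma>)"
    by (intro tendsto_intros assms) (use gamma_pos in auto)
  then have "(\<lambda>n. sqrt (energy (x n - w) (x n - w) / \<gamma>)) \<longlonglongrightarrow> 0"
    by (simp add: norm_a_square)
  then have "(\<lambda>n. norm (x n - w)) \<longlonglongrightarrow> 0"
    by (rule tendsto_sandwich[OF _ _ tendsto_const, rotated 2])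
      (auto simp: norm_le_energy)
  then show ?thesis by (simp add: LIM_zero_iff tendsto_norm_zero_iff)
qed

lemma norm_a_minus: "norm_a \<iota> a \<nu> (v - w) = norm_a \<iota> a \<nu> (w - v)"
  unfolding norm_a_energy energy_diff by (simp add: energy_sym[of v w])

text \<open>
  The convergence statements only use that the eigenvalue residuals of the iterates vanish in the
  limit; the condition on consecutive iterates prevents oscillation between \<open>w\<close> and \<open>- w\<close>.
\<close>

context
  fixes u :: "nat \<Rightarrow> 'v" and lam :: "nat \<Rightarrow> real" and D :: "'v set"
  assumes unit: "\<And>n. norm (\<iota> (u n)) = 1"
    and lam: "\<And>n. lam n = a (u n) (u n)"
    and dec: "decseq lam"
    and residual_0: "\<And>v. v \<in> D \<Longrightarrow> (\<lambda>n. residual (u n) (lam n) v) \<longlonglongrightarrow> 0"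
    and dense: "closure (span D) = UNIV"
begin

section \<open>Limits of iterates with vanishing residuals\<close>

lemma lam_lower: "- \<nu> \<le> lam n"
  using quotient_lower[of "u n"] by (simp add: quotient_def unit lam)

lemma iterates_norm_le: "norm (u n) \<le> sqrt ((lam 0 + \<nu>) / \<gamma>)"
proof -
  have "energy (u n) (u n) \<le> lam 0 + \<nu>"
    using decseqD[OF dec, of 0 n] by (simp add: energy_self unit lam)
  then have "sqrt (energy (u n) (u n) / \<gamma>) \<le> sqrt ((lam 0 + \<nu>) / \<gamma>)"
    using gamma_pos by (simp add: divide_right_mono)
  then show ?thesis using norm_le_energy order_trans by blast
qed

lemma iterates_bounded: "bounded (range u)"
  using iterates_norm_le by (auto intro!: boundedI)

text \<open>Boundedness of the iterates in V and of \<open>lam\<close> makes the residual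
  functionals uniformly bounded, which density of the span of \<open>D\<close> requires.\<close>

lemma residual_tendsto_0: "(\<lambda>n. residual (u n) (lam n) v) \<longlonglongrightarrow> 0"
proof -
  obtain k where k: "k \<ge> 0" "\<And>v w. \<bar>a v w\<bar> \<le> norm v * norm w * k"
    using form.nonneg_bounded by auto
  obtain i where i: "i \<ge> 0" "\<And>v. norm (\<iota> v) \<le> norm v * i"
    using iota.nonneg_bounded by auto
  define B where "B = sqrt ((lam 0 + \<nu>) / \<gamma>)"
  define L where "L = \<bar>lam 0\<bar> + \<nu>"
  show ?thesis
  proof (rule closure_induct_tendsto_0)
    show "\<bar>residual (u n) (lam n) v\<bar> \<le> (B * k + L * i) * norm v" for n v
    proof -
      have "\<bar>a (u n) v\<bar> \<le> norm (u n) * (norm v * k)" using k(2) by (simp add: mult.assoc)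
      also have "\<dots> \<le> B * (norm v * k)"
        unfolding B_def by (intro mult_right_mono iterates_norm_le) (use k in auto)
      finally have "\<bar>a (u n) v\<bar> \<le> B * (norm v * k)" .
      moreover have "\<bar>lam n * (\<iota> (u n) \<bullet> \<iota> v)\<bar> \<le> L * (norm v * i)"
        unfolding abs_mult
      proof (rule mult_mono)
        show "\<bar>lam n\<bar> \<le> L"
          using lam_lower[of n] decseqD[OF dec, of 0 n] nu_pos unfolding L_def by auto
        show "\<bar>\<iota> (u n) \<bullet> \<iota> v\<bar> \<le> norm v * i"
          using Cauchy_Schwarz_ineq2[of "\<iota> (u n)" "\<iota> v"] i(2)[of v] by (simp add: unit)
      qed (use nu_pos in \<open>auto simp: L_def\<close>)
      ultimately show ?thesis by (simp add: residual_def algebra_simps)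
    qed
    show "v \<in> closure (span D)" using dense by simp
  qed (simp_all add: linear_residual residual_0)
qed

lemma weak_subsequence_limit:
  assumes r: "strict_mono r" and w: "limitin weak_topology (u \<circ> r) w sequentially"
    and \<mu>: "lam \<longlonglongrightarrow> \<mu>"
  shows "w \<in> normalized_eigenvectors \<iota> a \<mu>" "(\<lambda>n. norm_a \<iota> a \<nu> (u (r n) - w)) \<longlonglongrightarrow> 0"
proof -
  have bd: "bounded (range (u \<circ> r))" by (rule bounded_subset[OF iterates_bounded]) auto
  have H: "(\<lambda>n. \<iota> (u (r n))) \<longlonglongrightarrow> \<iota> w"
    using weak_imp_H_strong[OF w bd] by (simp add: o_def)
  then have "(\<lambda>n. norm (\<iota> (u (r n)))) \<longlonglongrightarrow> norm (\<iota> w)" by (rule tendsto_norm)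
  then have w1: "norm (\<iota> w) = 1" by (simp add: unit LIMSEQ_const_iff)
  have lr: "(\<lambda>n. lam (r n)) \<longlonglongrightarrow> \<mu>"
    using LIMSEQ_subseq_LIMSEQ[OF \<mu> r] by (simp add: o_def)
  have eig: "a w v = \<mu> * (\<iota> w \<bullet> \<iota> v)" for v
  proof -
    have "(\<lambda>n. residual (u (r n)) (lam (r n)) v) \<longlonglongrightarrow> a w v - \<mu> * (\<iota> w \<bullet> \<iota> v)"
      unfolding residual_def
      by (intro tendsto_intros lr H
          limitin_weak_topologyD[OF w bounded_linear_form, unfolded o_def])
    moreover have "(\<lambda>n. residual (u (r n)) (lam (r n)) v) \<longlonglongrightarrow> 0"
      using LIMSEQ_subseq_LIMSEQ[OF residual_tendsto_0[of v] r] by (simp add: o_def)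
    ultimately show ?thesis using LIMSEQ_unique by fastforce
  qed
  then show "w \<in> normalized_eigenvectors \<iota> a \<mu>"
    using w1 by (auto simp: normalized_eigenvectors_def is_eigenvector_def)
  have "energy w w = \<mu> + \<nu>"
    using eig[of w] w1 by (simp add: energy_self power2_norm_eq_inner[symmetric])
  \<comment> \<open>The radicand is the expanded squared energy distance from \<open>u (r n)\<close>
    to \<open>w\<close>; since \<open>w\<close> has energy \<open>\<mu> + \<nu>\<close>, its limit
    is 0.\<close>
  moreover have "(\<lambda>n. sqrt (lam (r n) + \<nu> - 2 * energy (u (r n)) w + energy w w))
      \<longlonglongrightarrow> sqrt (\<mu> + \<nu> - 2 * energy w w + energy w w)"
    by (intro tendsto_intros lr
        limitin_weak_topologyD[OF w bounded_linear_energy, unfolded o_def])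
  ultimately show "(\<lambda>n. norm_a \<iota> a \<nu> (u (r n) - w)) \<longlonglongrightarrow> 0"
    by (simp add: norm_a_energy energy_diff energy_self[of "u _"] unit lam)
qed

lemma ex_weak_subsequence:
  fixes r :: "nat \<Rightarrow> nat"
  obtains s w where "strict_mono s" "limitin weak_topology (u \<circ> (r \<circ> s)) w sequentially"
proof -
  have "bounded (range (u \<circ> r))" by (rule bounded_subset[OF iterates_bounded]) auto
  from Hilbert_bounded_weak_subsequence[OF separable this] show ?thesis
    using that by (metis o_assoc)
qed

text \<open>Every subsequence has a further one converging to some normalized eigenvector, and the
  distance to that single vector dominates the infimum.\<close>

lemma distance_to_eigenvectors_tendsto_0:
  assumes \<mu>: "lam \<longlonglongrightarrow> \<mu>"
  shows "(\<lambda>n. INF w\<in>normalized_eigenvectors \<iota> a \<mu>. norm_a \<iota> a \<nu> (w - u n)) \<longlonglongrightarrow> 0"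
    (is "?d \<longlonglongrightarrow> 0")
proof (rule LIMSEQ_if_subsequences)
  fix r :: "nat \<Rightarrow> nat" assume r: "strict_mono r"
  obtain s w where s: "strict_mono s" "limitin weak_topology (u \<circ> (r \<circ> s)) w sequentially"
    by (rule ex_weak_subsequence)
  note lim = weak_subsequence_limit[OF strict_mono_o[OF r s(1)] s(2) \<mu>]
  have nonneg: "0 \<le> norm_a \<iota> a \<nu> v" for v by (simp add: norm_a_energy energy_nonneg)
  have "0 \<le> ?d n" for n by (rule cINF_greatest) (use lim(1) nonneg in auto)
  moreover have "?d n \<le> norm_a \<iota> a \<nu> (w - u n)" for n
    by (rule cINF_lower[OF bdd_belowI2[OF nonneg] lim(1)])
  ultimately have "(?d \<circ> r \<circ> s) \<longlonglongrightarrow> 0"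
    by (intro tendsto_sandwich[OF _ _ tendsto_const lim(2)]) (auto simp: o_def norm_a_minus)
  with s(1) show "\<exists>s. strict_mono s \<and> (?d \<circ> r \<circ> s) \<longlonglongrightarrow> 0" by blast
qed

text \<open>Nearly closest eigenvectors \<open>\<psi> n\<close> are used. Simplicity leaves only two
  candidates up to sign, and alignment forbids a change of sign once the errors are small, so
  \<open>\<psi>\<close> is eventually constant.\<close>

lemma simple_eigenvalue_convergence:
  assumes \<mu>: "lam \<longlonglongrightarrow> \<mu>" and simple: "is_simple_eigenvalue \<iota> a \<mu>"
    and aligned: "\<forall>\<^sub>F n in sequentially. 0 \<le> \<iota> (u n) \<bullet> \<iota> (u (Suc n))"
  shows "\<exists>w\<in>normalized_eigenvectors \<iota> a \<mu>. u \<longlonglongrightarrow> w"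
proof -
  define F where "F = normalized_eigenvectors \<iota> a \<mu>"
  define d where "d n = (INF w\<in>F. norm_a \<iota> a \<nu> (w - u n))" for n
  obtain s w where "strict_mono s" "limitin weak_topology (u \<circ> (id \<circ> s)) w sequentially"
    by (rule ex_weak_subsequence)
  then have "w \<in> F" using weak_subsequence_limit(1)[of s] \<mu> by (simp add: F_def)
  then have "F \<noteq> {}" by blast
  have "\<exists>w\<in>F. norm_a \<iota> a \<nu> (w - u n) < d n + 1 / Suc n" for n
    using cInf_lessD[of "(\<lambda>w. norm_a \<iota> a \<nu> (w - u n)) ` F" "d n + 1 / Suc n"] \<open>F \<noteq> {}\<close>
    by (auto simp: d_def)
  then obtain \<psi> where \<psi>: "\<And>n. \<psi> n \<in> F" "\<And>n. norm_a \<iota> a \<nu> (\<psi> n - u n) < d n + 1 / Suc n"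
    by metis
  define \<epsilon> where "\<epsilon> n = norm_a \<iota> a \<nu> (\<psi> n - u n)" for n
  have "\<epsilon> \<longlonglongrightarrow> 0"
  proof (rule tendsto_sandwich[OF _ _ tendsto_const])
    show "(\<lambda>n. d n + 1 / Suc n) \<longlonglongrightarrow> 0"
      using tendsto_add[OF distance_to_eigenvectors_tendsto_0[OF \<mu>, folded F_def, folded d_def]
          LIMSEQ_inverse_real_of_nat[unfolded inverse_eq_divide]] by simp
    show "\<forall>\<^sub>F n in sequentially. \<epsilon> n \<le> d n + 1 / Suc n" using \<psi>(2) by (simp add: \<epsilon>_def less_imp_le)
  qed (simp add: \<epsilon>_def norm_a_energy energy_nonneg)
  \<comment> \<open>Two errors below 1/2 cannot carry an inner product from a nonnegative value down
    to -1, its value for opposite unit vectors.\<close>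
  then have "\<forall>\<^sub>F n in sequentially. \<epsilon> n < 1 / 2" by (rule order_tendstoD) simp
  moreover from this have "\<forall>\<^sub>F n in sequentially. \<epsilon> (Suc n) < 1 / 2"
    by (rule eventually_all_ge_at_top[THEN eventually_mono]) simp
  ultimately have "\<forall>\<^sub>F n in sequentially. \<psi> (Suc n) = \<psi> n"
    using aligned
  proof eventually_elim
    case (elim n)
    define p h where "p k = \<iota> (\<psi> k)" and "h k = \<iota> (u k)" for k
    have p1: "norm (p k) = 1" for k
      using \<psi>(1)[of k] by (simp add: p_def F_def normalized_eigenvectors_def)
    have ph: "norm (p k - h k) \<le> \<epsilon> k" for k
      using norm_le_norm_a[of "\<psi> k - u k"] by (simp add: p_def h_def \<epsilon>_def iota.diff)
    have "p n \<bullet> p (Suc n) = (p n - h n) \<bullet> p (Suc n) + h n \<bullet> (p (Suc n) - h (Suc n)) + h n \<bullet> h (Suc n)"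
      by (simp add: inner_diff_left inner_diff_right)
    moreover have "\<bar>(p n - h n) \<bullet> p (Suc n)\<bar> \<le> \<epsilon> n"
      using Cauchy_Schwarz_ineq2[of "p n - h n" "p (Suc n)"] ph[of n] by (simp add: p1)
    moreover have "\<bar>h n \<bullet> (p (Suc n) - h (Suc n))\<bar> \<le> \<epsilon> (Suc n)"
      using Cauchy_Schwarz_ineq2[of "h n" "p (Suc n) - h (Suc n)"] ph[of "Suc n"]
      by (simp add: h_def unit)
    ultimately have "- 1 < p n \<bullet> p (Suc n)" using elim by (simp add: h_def)
    then have "p (Suc n) \<noteq> - p n" using p1[of n] by (auto simp: norm_eq_1)
    then have "\<psi> (Suc n) \<noteq> - \<psi> n" by (auto simp: p_def iota.neg)
    then show ?case
      using simple_eigenvalue_normalized_eigenvectors[OF simple] \<psi>(1) by (auto simp: F_def)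
  qed
  then obtain N where N: "\<And>n. n \<ge> N \<Longrightarrow> \<psi> (Suc n) = \<psi> n"
    by (auto simp: eventually_sequentially)
  have const: "\<psi> n = \<psi> N" if "n \<ge> N" for n
    using that by (induction n rule: dec_induct) (simp_all add: N)
  have "u \<longlonglongrightarrow> \<psi> N"
  proof (rule strong_if_norm_a)
    have "\<forall>\<^sub>F n in sequentially. \<epsilon> n = norm_a \<iota> a \<nu> (u n - \<psi> N)"
      unfolding eventually_sequentially \<epsilon>_def by (metis const norm_a_minus)
    then show "(\<lambda>n. norm_a \<iota> a \<nu> (u n - \<psi> N)) \<longlonglongrightarrow> 0"
      using \<open>\<epsilon> \<longlonglongrightarrow> 0\<close> by (rule Lim_transform_eventually[rotated])
  qed
  then show ?thesis using \<psi>(1) F_def by blast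
qed

lemma vanishing_residuals_convergence:
  assumes aligned: "\<forall>\<^sub>F n in sequentially. 0 \<le> \<iota> (u n) \<bullet> \<iota> (u (Suc n))"
  shows "\<exists>\<mu>. lam \<longlonglongrightarrow> \<mu> \<and> is_eigenvalue \<iota> a \<mu> \<and> bounded (range u) \<and>
    (\<forall>r w. strict_mono r \<and> limitin weak_topology (u \<circ> r) w sequentially \<longrightarrow>
      (\<exists>\<psi>\<in>normalized_eigenvectors \<iota> a \<mu>. (u \<circ> r) \<longlonglongrightarrow> \<psi>)) \<and>
    (\<lambda>n. INF w\<in>normalized_eigenvectors \<iota> a \<mu>. norm_a \<iota> a \<nu> (w - u n)) \<longlonglongrightarrow> 0 \<and>
    (is_simple_eigenvalue \<iota> a \<mu> \<longrightarrow> (\<exists>w\<in>normalized_eigenvectors \<iota> a \<mu>. u \<longlonglongrightarrow> w))"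
proof -
  obtain \<mu> where \<mu>: "lam \<longlonglongrightarrow> \<mu>"
    using decseq_convergent[OF dec] lam_lower by blast
  obtain s w where "strict_mono s" "limitin weak_topology (u \<circ> (id \<circ> s)) w sequentially"
    by (rule ex_weak_subsequence)
  then have "w \<in> normalized_eigenvectors \<iota> a \<mu>" using weak_subsequence_limit(1)[of s] \<mu> by simp
  then have "is_eigenvalue \<iota> a \<mu>"
    by (auto simp: normalized_eigenvectors_def is_eigenvalue_def)
  moreover have "\<exists>\<psi>\<in>normalized_eigenvectors \<iota> a \<mu>. (u \<circ> r) \<longlonglongrightarrow> \<psi>"
    if "strict_mono r" "limitin weak_topology (u \<circ> r) w sequentially" for r w
  proof (rule bexI)
    show "(u \<circ> r) \<longlonglongrightarrow> w"
      by (rule strong_if_norm_a) (use weak_subsequence_limit(2)[OF that \<mu>] in simp)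
  qed (rule weak_subsequence_limit(1)[OF that \<mu>])
  ultimately show ?thesis
    using \<mu> iterates_bounded distance_to_eigenvectors_tendsto_0[OF \<mu>]
      simple_eigenvalue_convergence[OF \<mu> _ aligned] by blast
qed

end

end

section \<open>One minimization step\<close>

context compactly_embedded_form
begin

text \<open>The competitor \<open>0\<close> has a finite value, so no minimizer takes the value
  \<infinity> that encodes \<open>u + z = 0\<close>.\<close>

lemma argmin_rayleigh_iff:
  assumes "uses_rayleigh alg" "0 \<in> D" "u \<noteq> 0"
  shows "dict_argmin alg \<iota> a \<nu> D u l z \<longleftrightarrow>
    z \<in> D \<and> u + z \<noteq> 0 \<and> (\<forall>y\<in>D. u + y \<noteq> 0 \<longrightarrow> quotient (u + z) \<le> quotient (u + y))"
    (is "?L \<longleftrightarrow> ?R")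
proof -
  have L: "?L \<longleftrightarrow> z \<in> D \<and> (\<forall>y\<in>D. rayleigh \<iota> a (u + z) \<le> rayleigh \<iota> a (u + y))"
    using assms(1) by (auto simp: dict_argmin_def is_arg_min_def dict_objective_def not_less)
  show ?thesis
  proof
    assume ?L
    then have z: "z \<in> D" "\<And>y. y \<in> D \<Longrightarrow> rayleigh \<iota> a (u + z) \<le> rayleigh \<iota> a (u + y)"
      using L by auto
    from z(2)[OF assms(2)] assms(3) have "u + z \<noteq> 0"
      by (auto simp: rayleigh_quotient split: if_splits)
    moreover have "quotient (u + z) \<le> quotient (u + y)" if "y \<in> D" "u + y \<noteq> 0" for y
      using z(2)[OF that(1)] that(2) \<open>u + z \<noteq> 0\<close> by (simp add: rayleigh_quotient)
    ultimately show ?R using z(1) by blast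
  next
    assume ?R
    then show ?L unfolding L by (auto simp: rayleigh_quotient)
  qed
qed

lemma argmin_residual_iff:
  assumes "\<not> uses_rayleigh alg"
  shows "dict_argmin alg \<iota> a \<nu> D u l z \<longleftrightarrow>
    z \<in> D \<and> (\<forall>y\<in>D. residual_objective u l z \<le> residual_objective u l y)"
  using assms
  by (auto simp: dict_argmin_def is_arg_min_def dict_objective_def not_less
      residual_objective_def norm_a_square)

text \<open>The generators may be linearly dependent, so minimality is better expressed through
  represented vectors than through coefficients.\<close>

lemma coeff_argmin_iff:
  "coeff_argmin \<iota> a v z n c \<longleftrightarrow> c \<in> {..n} \<rightarrow>\<^sub>E UNIV \<and>
    (\<forall>y\<in>span (insert v (z ` {1..n})). rayleigh \<iota> a (lin_comb v z n c) \<le> rayleigh \<iota> a y)"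
    (is "_ \<longleftrightarrow> _ \<and> ?R")
proof -
  have "(\<forall>d\<in>{..n} \<rightarrow>\<^sub>E UNIV. rayleigh \<iota> a (lin_comb v z n c) \<le> rayleigh \<iota> a (lin_comb v z n d)) \<longleftrightarrow> ?R"
    using lin_comb_in_span span_lin_comb by metis
  then show ?thesis by (auto simp: coeff_argmin_def is_arg_min_def not_less)
qed

lemma coeff_argminD:
  assumes "coeff_argmin \<iota> a v z n c" "v \<noteq> 0"
  shows "lin_comb v z n c \<noteq> 0"
    and "\<And>y. y \<in> span (insert v (z ` {1..n})) \<Longrightarrow> y \<noteq> 0 \<Longrightarrow> quotient (lin_comb v z n c) \<le> quotient y"
proof -
  have le: "rayleigh \<iota> a (lin_comb v z n c) \<le> rayleigh \<iota> a y"
    if "y \<in> span (insert v (z ` {1..n}))" for y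
    using assms(1) that by (auto simp: coeff_argmin_iff)
  show nz: "lin_comb v z n c \<noteq> 0"
    using le[OF span_base[OF insertI1]] assms(2) by (auto simp: rayleigh_quotient)
  show "quotient (lin_comb v z n c) \<le> quotient y"
    if "y \<in> span (insert v (z ` {1..n}))" "y \<noteq> 0" for y
    using le[OF that(1)] nz that(2) by (simp add: rayleigh_quotient)
qed

lemma ex_coeff_argmin:
  assumes "v \<noteq> 0"
  shows "\<exists>c. coeff_argmin \<iota> a v z n c"
proof -
  let ?S = "insert v (z ` {1..n})"
  obtain w where w: "w \<in> span ?S" "w \<noteq> 0" "\<forall>y\<in>span ?S. y \<noteq> 0 \<longrightarrow> quotient w \<le> quotient y"
    using ex_minimizer_quotient_span[of ?S v] assms by (auto simp: span_base)
  obtain c where "c \<in> {..n} \<rightarrow>\<^sub>E UNIV" "lin_comb v z n c = w" using span_lin_comb[OF w(1)] .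
  with w show ?thesis by (auto simp: coeff_argmin_iff rayleigh_quotient)
qed

lemma norm_H_normalize: "v \<noteq> 0 \<Longrightarrow> norm (\<iota> (H_normalize \<iota> v)) = 1"
  by (simp add: H_normalize_def iota.scaleR)

lemma form_H_normalize: "v \<noteq> 0 \<Longrightarrow> a (H_normalize \<iota> v) (H_normalize \<iota> v) = quotient v"
  using quotient_scaleR[of "inverse (norm (\<iota> v))" v]
  by (simp add: H_normalize_def form_quotient[of "_ /\<^sub>R _"] iota.scaleR)

lemma flip_sign_cases: "flip_sign \<iota> v w = w \<or> flip_sign \<iota> v w = - w"
  by (simp add: flip_sign_def)

lemma flip_sign_aligned: "0 \<le> \<iota> v \<bullet> \<iota> (flip_sign \<iota> v w)"
  by (simp add: flip_sign_def iota.neg)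

text \<open>Minimality along the line through a dictionary element bounds the residual there.\<close>

lemma rayleigh_step:
  assumes cone: "\<And>y t. y \<in> D \<Longrightarrow> t *\<^sub>R y \<in> D"
    and u: "norm (\<iota> u) = 1" and z: "z \<in> D" "u + z \<noteq> 0"
    and min: "\<And>y. y \<in> D \<Longrightarrow> u + y \<noteq> 0 \<Longrightarrow> quotient (u + z) \<le> quotient (u + y)"
    and gap: "a u u < l" "\<And>y. y \<in> D \<Longrightarrow> l * (norm (\<iota> y))\<^sup>2 \<le> a y y"
  defines "q \<equiv> quotient (u + z)"
  shows "q \<le> a u u"
    and "\<And>y. y \<in> D \<Longrightarrow> (residual u q y)\<^sup>2 \<le> (a u u - q) * energy y y"
    and "(l - a u u) * (norm (\<iota> z))\<^sup>2 \<le> a u u - q"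
proof -
  have expand: "a (u + y) (u + y) - q * (norm (\<iota> (u + y)))\<^sup>2
      = (a y y - q * (norm (\<iota> y))\<^sup>2) + 2 * residual u q y + (a u u - q)" for y
    using u unfolding power2_norm_eq_inner norm_eq_1
    by (simp add: residual_def form_expand sym[of y u] inner_commute[of "\<iota> y" "\<iota> u"] algebra_simps)
  have ineq: "0 \<le> t\<^sup>2 * (a y y - q * (norm (\<iota> y))\<^sup>2) + 2 * t * residual u q y + (a u u - q)"
    if "y \<in> D" for y t
  proof -
    have "q * (norm (\<iota> (u + t *\<^sub>R y)))\<^sup>2 \<le> a (u + t *\<^sub>R y) (u + t *\<^sub>R y)"
    proof (cases "u + t *\<^sub>R y = 0")
      case False
      then show ?thesis unfolding form_quotient q_def
        by (intro mult_right_mono min cone that) auto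
    qed (simp add: form.zero_left)
    then show ?thesis using expand[of "t *\<^sub>R y"]
      by (simp add: residual_def form_expand power_mult_distrib power2_eq_square[of t] algebra_simps)
  qed
  show q: "q \<le> a u u" using ineq[OF z(1), of 0] by simp
  \<comment> \<open>Here the gap enters: dictionary elements have curvature at least
    \<open>l - q\<close>, which makes the leading coefficient of the polynomial nonnegative.\<close>
  have curv: "(l - q) * (norm (\<iota> y))\<^sup>2 \<le> a y y - q * (norm (\<iota> y))\<^sup>2" if "y \<in> D" for y
    using gap(2)[OF that] by (simp add: algebra_simps)
  have discr: "(residual u q y)\<^sup>2 \<le> (a u u - q) * (a y y - q * (norm (\<iota> y))\<^sup>2)" if "y \<in> D" for y
  proof (rule nonneg_quadratic_discriminant[OF ineq[OF that]])
    have "0 \<le> (l - q) * (norm (\<iota> y))\<^sup>2" using gap(1) q by simp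
    then show "0 \<le> a y y - q * (norm (\<iota> y))\<^sup>2" using curv[OF that] by linarith
  qed
  show "(residual u q y)\<^sup>2 \<le> (a u u - q) * energy y y" if "y \<in> D" for y
  proof -
    have "- \<nu> * (norm (\<iota> y))\<^sup>2 \<le> q * (norm (\<iota> y))\<^sup>2"
      unfolding q_def by (intro mult_right_mono quotient_lower) auto
    then have "(a u u - q) * (a y y - q * (norm (\<iota> y))\<^sup>2) \<le> (a u u - q) * energy y y"
      using q by (intro mult_left_mono) (auto simp: energy_self)
    then show ?thesis using discr[OF that] by linarith
  qed
  define c r d where "c = a z z - q * (norm (\<iota> z))\<^sup>2" and "r = residual u q z" and "d = a u u - q"
  \<comment> \<open>The polynomial belonging to \<open>z\<close> vanishes at \<open>t = 1\<close>.
    Being nonnegative, it has a double root there, which forces \<open>c = d\<close>; the curvature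
    \<open>c\<close> then controls the H-norm of \<open>z\<close>.\<close>
  have "c + 2 * r + d = 0"
    using expand[of z] form_quotient[of "u + z"] by (simp add: q_def c_def r_def d_def)
  then have r: "c + d = - 2 * r" by linarith
  have "r\<^sup>2 \<le> d * c" using discr[OF z(1)] by (simp add: c_def r_def d_def)
  then have "(c + d)\<^sup>2 \<le> 4 * (d * c)" unfolding r by (simp add: power_mult_distrib)
  then have "(c - d)\<^sup>2 \<le> 0" by (simp add: power2_eq_square algebra_simps)
  then have "c = d" by simp
  moreover have "(l - a u u) * (norm (\<iota> z))\<^sup>2 \<le> (l - q) * (norm (\<iota> z))\<^sup>2"
    using q by (intro mult_right_mono) auto
  ultimately show "(l - a u u) * (norm (\<iota> z))\<^sup>2 \<le> a u u - q"
    using curv[OF z(1)] by (simp add: c_def d_def)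
qed

text \<open>On a line the objective is \<open>t * r y + t\<^sup>2 * e y / 2\<close> up to a
  constant. Optimal scaling of \<open>z\<close> determines \<open>r z\<close>, comparison with other
  lines bounds the residuals, and expanding the quotient of \<open>u + z\<close> converts the energy
  of \<open>z\<close> into a drop of the quotient.\<close>

lemma residual_step:
  assumes cone: "\<And>y t. y \<in> D \<Longrightarrow> t *\<^sub>R y \<in> D"
    and u: "norm (\<iota> u) = 1" and z: "z \<in> D"
    and min: "\<And>y. y \<in> D \<Longrightarrow> residual_objective u (a u u) z \<le> residual_objective u (a u u) y"
  defines "q \<equiv> quotient (u + z)"
  shows "u + z \<noteq> 0"
    and "\<And>y. y \<in> D \<Longrightarrow> (residual u (a u u) y)\<^sup>2 \<le> energy z z * energy y y"
    and "q \<le> a u u"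
    and "energy z z \<le> (a u u - q) * (1 + norm (\<iota> z))\<^sup>2"
proof -
  define m where "m = a u u + \<nu>"
  have m: "energy u u = m" using u by (simp add: energy_self m_def)
  then have m1: "m \<ge> 1" using norm_H_le_energy[of u] u by simp
  define r e where "r y = residual u (a u u) y" and "e y = energy y y" for y
  have energy_add: "energy (u + y) (u + y) = m + 2 * r y + 2 * m * (\<iota> u \<bullet> \<iota> y) + e y" for y
    by (simp add: e_def r_def m[symmetric] residual_def energy_def form_expand sym[of y u]
        inner_commute[of "\<iota> y" "\<iota> u"] algebra_simps)
       (use u in \<open>simp add: norm_eq_1\<close>)
  have obj: "residual_objective u (a u u) y = m / 2 + r y + e y / 2" for y
    unfolding residual_objective_def energy_add m_def[symmetric] by (simp add: field_simps)
  have scale: "r (t *\<^sub>R y) = t * r y" "e (t *\<^sub>R y) = t\<^sup>2 * e y" for t y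
    by (simp_all add: r_def e_def residual_def energy_def form_expand power2_eq_square algebra_simps)
  have line: "r z + e z / 2 \<le> t * r y + t\<^sup>2 * e y / 2" if "y \<in> D" for t y
    using min[OF cone[OF that]] unfolding obj scale by simp
  have e0: "0 \<le> e y" for y by (simp add: e_def energy_nonneg)
  \<comment> \<open>The constant term is chosen so that the polynomial vanishes at
    \<open>t = 1\<close>; nonnegativity makes this a double root, hence
    \<open>r z = - e z\<close>.\<close>
  have "(r z)\<^sup>2 \<le> (- (2 * r z + e z)) * e z"
  proof (rule nonneg_quadratic_discriminant)
    show "0 \<le> t\<^sup>2 * e z + 2 * t * r z + - (2 * r z + e z)" for t
      using line[OF z, of t] by linarith
  qed (rule e0)
  then have "(r z + e z)\<^sup>2 \<le> 0" by (simp add: power2_eq_square algebra_simps)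
  then have rz: "r z = - e z" by simp
  show "(residual u (a u u) y)\<^sup>2 \<le> energy z z * energy y y" if "y \<in> D" for y
    unfolding r_def[symmetric] e_def[symmetric]
  proof (rule nonneg_quadratic_discriminant)
    show "0 \<le> t\<^sup>2 * e y + 2 * t * r y + e z" for t
      using line[OF that, of t] rz by linarith
  qed (rule e0)
  \<comment> \<open>For \<open>z = - u\<close> the residual \<open>r z\<close> is 0, because
    \<open>a u u\<close> is the quotient of \<open>u\<close> itself, while \<open>e z = m\<close> is
    positive.\<close>
  show nz: "u + z \<noteq> 0"
  proof
    assume "u + z = 0"
    then have "z = - u" by (simp add: eq_neg_iff_add_eq_0 add.commute)
    then have "r z = 0" "e z = m"
      using u m by (simp_all add: r_def residual_def e_def energy_def form_expand norm_eq_1)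
    then show False using rz m1 by simp
  qed
  define s where "s = (norm (\<iota> (u + z)))\<^sup>2"
  have s: "s > 0" using nz by (simp add: s_def)
  have s_expand: "s = 1 + 2 * (\<iota> u \<bullet> \<iota> z) + (norm (\<iota> z))\<^sup>2"
    using u unfolding s_def power2_norm_eq_inner norm_eq_1
    by (simp add: form_expand inner_commute)
  have "(q + \<nu>) * s = energy (u + z) (u + z)"
    by (simp add: energy_self form_quotient[of "u + z"] q_def s_def algebra_simps)
  \<comment> \<open>Substituting \<open>r z = - e z\<close> and completing \<open>m * s\<close>
    removes the mixed H-term; the remaining two summands are the exact drop of the quotient times
    \<open>s\<close>.\<close>
  also have "\<dots> = m * s - m * (norm (\<iota> z))\<^sup>2 - e z"
    unfolding energy_add rz s_expand by (simp add: algebra_simps)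
  finally have "e z + m * (norm (\<iota> z))\<^sup>2 = (a u u - q) * s"
    by (simp add: m_def algebra_simps)
  moreover have "0 \<le> m * (norm (\<iota> z))\<^sup>2" using m1 by simp
  ultimately have ez: "e z \<le> (a u u - q) * s" by linarith
  then have "0 \<le> (a u u - q) * s" using e0[of z] by linarith
  then show q: "q \<le> a u u" using s by (simp add: zero_le_mult_iff)
  have "s \<le> (1 + norm (\<iota> z))\<^sup>2"
    unfolding s_def using norm_triangle_ineq[of "\<iota> u" "\<iota> z"] u
    by (intro power_mono) (simp_all add: iota.add)
  then have "(a u u - q) * s \<le> (a u u - q) * (1 + norm (\<iota> z))\<^sup>2"
    using q by (intro mult_left_mono) auto
  with ez show "energy z z \<le> (a u u - q) * (1 + norm (\<iota> z))\<^sup>2" by (simp add: e_def)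
qed

text \<open>With \<open>x\<close> the energy norm of \<open>z\<close> and \<open>s = sqrt d\<close>,
  the hypothesis gives \<open>x \<le> s + s * x\<close>. The bound \<open>d \<le> 1 / 4\<close>
  means \<open>s \<le> 1 / 2\<close>, so the last term is absorbed on the left.\<close>

lemma small_energy:
  assumes "energy z z \<le> d * (1 + norm (\<iota> z))\<^sup>2" "0 \<le> d" "d \<le> 1 / 4"
  shows "energy z z \<le> 4 * d"
proof -
  define x s where "x = sqrt (energy z z)" and "s = sqrt d"
  have x0: "0 \<le> x" and s0: "0 \<le> s" using assms energy_nonneg by (auto simp: x_def s_def)
  have "norm (\<iota> z) \<le> x"
    using norm_le_norm_a[of z] by (simp add: x_def norm_a_energy)
  have "x \<le> s * (1 + norm (\<iota> z))"
    using real_sqrt_le_mono[OF assms(1)] by (simp add: x_def s_def real_sqrt_mult)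
  also have "\<dots> \<le> s * (1 + x)" using \<open>norm (\<iota> z) \<le> x\<close> s0 by (intro mult_left_mono) auto
  also have "\<dots> = s + s * x" by (simp add: algebra_simps)
  also have "s * x \<le> 1 / 2 * x"
  proof (intro mult_right_mono x0)
    show "s \<le> 1 / 2" unfolding s_def
      by (rule real_le_lsqrt) (use assms in \<open>auto simp: power2_eq_square\<close>)
  qed
  finally have "x \<le> 2 * s" by simp
  then have "x\<^sup>2 \<le> (2 * s)\<^sup>2" using x0 by (rule power_mono)
  then show ?thesis using assms energy_nonneg by (simp add: x_def s_def power_mult_distrib)
qed

end

section \<open>Runs of the algorithms\<close>

lemma greedy_run_imp_upto:
  "greedy_run alg \<iota> a \<nu> D z u lam \<Longrightarrow> greedy_run_upto alg \<iota> a \<nu> D z u lam N"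
  by (simp add: greedy_run_def greedy_run_upto_def)

context compactly_embedded_form
begin

context
  fixes D :: "'v set"
  assumes dict: "dictionary D"
begin

section \<open>Well-definedness and invariants of finite runs\<close>

lemma dict_facts:
  "0 \<in> D" "closedin weak_topology D" "closure (span D) = UNIV" "y \<in> D \<Longrightarrow> t *\<^sub>R y \<in> D"
  using dict by (auto simp: dictionary_def)

text \<open>The infimum is an extended real. A real \<open>l\<close> strictly below it and above
  \<open>m\<close> leaves the positive margin \<open>l - m\<close> on which the Rayleigh estimates
  rest.\<close>

lemma lambda_dict_gap:
  assumes "ereal m < lambda_dict \<iota> a D"
  obtains l where "m < l" "\<And>y. y \<in> D \<Longrightarrow> l * (norm (\<iota> y))\<^sup>2 \<le> a y y"
proof -
  obtain l where l: "ereal m < ereal l" "ereal l < lambda_dict \<iota> a D"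
    using ereal_dense2[OF assms] by blast
  have "l * (norm (\<iota> y))\<^sup>2 \<le> a y y" if "y \<in> D" for y
  proof (cases "y = 0")
    case False
    have "ereal l \<le> rayleigh \<iota> a y"
      using l(2) INF_lower[of y "D - {0}" "rayleigh \<iota> a"] that False
      unfolding lambda_dict_def by (meson DiffI less_imp_le order_trans singletonD)
    then have "l \<le> quotient y" using False by (simp add: rayleigh_quotient)
    then show ?thesis unfolding form_quotient by (rule mult_right_mono) simp
  qed (simp add: form.zero_left)
  with l(1) show ?thesis by (intro that[of l]) auto
qed

lemma ex_dict_argmin:
  assumes u: "norm (\<iota> v) = 1" and gap: "uses_rayleigh alg \<Longrightarrow> ereal (a v v) < lambda_dict \<iota> a D"
  shows "\<exists>\<zeta>. dict_argmin alg \<iota> a \<nu> D v (a v v) \<zeta>"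
proof (cases "uses_rayleigh alg")
  case True
  obtain l where l: "a v v < l" "\<And>y. y \<in> D \<Longrightarrow> l * (norm (\<iota> y))\<^sup>2 \<le> a y y"
    using lambda_dict_gap[OF gap[OF True]] by blast
  have "v \<noteq> 0" using u by auto
  then show ?thesis
    using ex_minimizer_quotient_translate[OF dict_facts(2,1) u l]
    by (auto simp: argmin_rayleigh_iff[OF True dict_facts(1)])
next
  case False
  then show ?thesis
    using ex_minimizer_residual_objective[OF dict_facts(2,1), of v "a v v"]
    by (auto simp: argmin_residual_iff)
qed

lemma dict_argminD:
  assumes u: "norm (\<iota> v) = 1" and gap: "uses_rayleigh alg \<Longrightarrow> ereal (a v v) < lambda_dict \<iota> a D"
    and z: "dict_argmin alg \<iota> a \<nu> D v (a v v) \<zeta>"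
  shows "v + \<zeta> \<noteq> 0" "quotient (v + \<zeta>) \<le> a v v"
proof -
  have "v + \<zeta> \<noteq> 0 \<and> quotient (v + \<zeta>) \<le> a v v"
  proof (cases "uses_rayleigh alg")
    case True
    obtain l where l: "a v v < l" "\<And>y. y \<in> D \<Longrightarrow> l * (norm (\<iota> y))\<^sup>2 \<le> a y y"
      using lambda_dict_gap[OF gap[OF True]] by blast
    have "v \<noteq> 0" using u by auto
    then show ?thesis
      using z rayleigh_step(1)[OF dict_facts(4) u _ _ _ l, of \<zeta>]
      by (auto simp: argmin_rayleigh_iff[OF True dict_facts(1)])
  next
    case False
    then show ?thesis
      using z residual_step(1,3)[OF dict_facts(4) u, of \<zeta>] by (auto simp: argmin_residual_iff)
  qed
  then show "v + \<zeta> \<noteq> 0" "quotient (v + \<zeta>) \<le> a v v" by auto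
qed

lemma greedy_step_properties:
  assumes step: "greedy_step alg \<iota> a \<nu> D z u lam (Suc n)"
    and u: "norm (\<iota> (u n)) = 1" "lam n = a (u n) (u n)"
    and gap: "uses_rayleigh alg \<Longrightarrow> ereal (lam n) < lambda_dict \<iota> a D"
    and span: "is_orthogonal alg \<Longrightarrow> u n \<in> span (insert (u 0) (z ` {1..n}))"
    and u0: "norm (\<iota> (u 0)) = 1"
  shows "norm (\<iota> (u (Suc n))) = 1" "lam (Suc n) = a (u (Suc n)) (u (Suc n))"
    and "lam (Suc n) \<le> quotient (u n + z (Suc n))" "quotient (u n + z (Suc n)) \<le> lam n"
    and "is_orthogonal alg \<Longrightarrow> u (Suc n) \<in> span (insert (u 0) (z ` {1..Suc n}))"
    and "is_orthogonal alg \<Longrightarrow> 0 \<le> \<iota> (u n) \<bullet> \<iota> (u (Suc n))"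
proof -
  define w where "w = u n + z (Suc n)"
  have argmin: "dict_argmin alg \<iota> a \<nu> D (u n) (a (u n) (u n)) (z (Suc n))"
    using step u(2) by (simp add: greedy_step_def)
  note w = dict_argminD[OF u(1) gap[unfolded u(2)] argmin, folded w_def]
  then show "quotient (u n + z (Suc n)) \<le> lam n" by (simp add: u(2) w_def)
  show lam: "lam (Suc n) = a (u (Suc n)) (u (Suc n))" using step by (simp add: greedy_step_def)
  have "norm (\<iota> (u (Suc n))) = 1 \<and> lam (Suc n) \<le> quotient w \<and>
    (is_orthogonal alg \<longrightarrow> u (Suc n) \<in> span (insert (u 0) (z ` {1..Suc n})) \<and>
      0 \<le> \<iota> (u n) \<bullet> \<iota> (u (Suc n)))"
  proof (cases "is_orthogonal alg")
    case True
    let ?S = "insert (u 0) (z ` {1..Suc n})"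
    obtain c where c: "coeff_argmin \<iota> a (u 0) z (Suc n) c"
      and uc: "u (Suc n) = flip_sign \<iota> (u n) (H_normalize \<iota> (lin_comb (u 0) z (Suc n) c))"
      using step True by (auto simp: greedy_step_def)
    define x where "x = lin_comb (u 0) z (Suc n) c"
    have "u 0 \<noteq> 0" using u0 by auto
    note x = coeff_argminD[OF c this, folded x_def]
    have "x \<in> span ?S" unfolding x_def by (rule lin_comb_in_span)
    then have "H_normalize \<iota> x \<in> span ?S" "- H_normalize \<iota> x \<in> span ?S"
      by (auto simp: H_normalize_def intro: span_scale span_neg)
    moreover have cases: "u (Suc n) = H_normalize \<iota> x \<or> u (Suc n) = - H_normalize \<iota> x"
      unfolding uc x_def by (rule flip_sign_cases)
    ultimately have "u (Suc n) \<in> span ?S" by metis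
    \<comment> \<open>Thus the unnormalized pure step from \<open>u n\<close> competes in the
      minimization over coefficients, and the orthogonal update is at least as good.\<close>
    moreover have "w \<in> span ?S"
    proof -
      have "u n \<in> span ?S" using span[OF True] by (rule subsetD[OF span_mono, rotated]) auto
      moreover have "z (Suc n) \<in> span ?S" by (rule span_base) auto
      ultimately show ?thesis unfolding w_def by (rule span_add)
    qed
    moreover have "w \<noteq> 0" by (rule w(1))
    moreover have "norm (\<iota> (u (Suc n))) = 1" "lam (Suc n) = quotient x"
      using cases norm_H_normalize[OF x(1)] form_H_normalize[OF x(1)]
      by (auto simp: lam iota.neg form.minus_left form.minus_right)
    moreover have "0 \<le> \<iota> (u n) \<bullet> \<iota> (u (Suc n))" unfolding uc by (rule flip_sign_aligned)
    ultimately show ?thesis using x(2)[of w] by simp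
  next
    case False
    then have "u (Suc n) = H_normalize \<iota> w" using step by (simp add: greedy_step_def w_def)
    then show ?thesis using False w by (simp add: lam norm_H_normalize form_H_normalize)
  qed
  then show "norm (\<iota> (u (Suc n))) = 1" "lam (Suc n) \<le> quotient (u n + z (Suc n))"
    "is_orthogonal alg \<Longrightarrow> u (Suc n) \<in> span (insert (u 0) (z ` {1..Suc n}))"
    "is_orthogonal alg \<Longrightarrow> 0 \<le> \<iota> (u n) \<bullet> \<iota> (u (Suc n))"
    by (auto simp: w_def)
qed

text \<open>The clause \<open>lam n \<le> lam 0\<close> passes the initial gap on to every step, and
  the span clause is what the next orthogonal step needs. Finite runs are considered so that
  well-definedness of the following iteration can be deduced.\<close>

lemma greedy_run_upto_invariant:
  assumes run: "greedy_run_upto alg \<iota> a \<nu> D z u lam N" and "n \<le> N"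
  shows "norm (\<iota> (u n)) = 1 \<and> lam n = a (u n) (u n) \<and> lam n \<le> lam 0 \<and>
    (is_orthogonal alg \<longrightarrow> u n \<in> span (insert (u 0) (z ` {1..n})))"
  using assms(2)
proof (induction n)
  case 0
  then show ?case using run by (auto simp: greedy_run_upto_def greedy_init_def span_base)
next
  case (Suc n)
  have init: "norm (\<iota> (u 0)) = 1" "uses_rayleigh alg \<Longrightarrow> ereal (lam 0) < lambda_dict \<iota> a D"
    using run by (auto simp: greedy_run_upto_def greedy_init_def)
  have step: "greedy_step alg \<iota> a \<nu> D z u lam (Suc n)"
    using run Suc.prems by (simp add: greedy_run_upto_def)
  have IH: "norm (\<iota> (u n)) = 1" "lam n = a (u n) (u n)" "lam n \<le> lam 0"
    "is_orthogonal alg \<Longrightarrow> u n \<in> span (insert (u 0) (z ` {1..n}))"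
    using Suc by auto
  have gap: "ereal (lam n) < lambda_dict \<iota> a D" if "uses_rayleigh alg"
    using init(2)[OF that] IH(3) by (meson ereal_less_eq(3) order_le_less_trans)
  note p = greedy_step_properties[OF step IH(1,2) gap IH(4) init(1)]
  show ?case using p(1-5) IH(3) by simp
qed

lemma iteration_well_defined:
  assumes run: "greedy_run_upto alg \<iota> a \<nu> D z u lam (n - 1)"
  shows "iteration_well_defined alg \<iota> a \<nu> D z u lam n"
proof -
  have inv: "norm (\<iota> (u (n - 1))) = 1" "lam (n - 1) = a (u (n - 1)) (u (n - 1))"
    "lam (n - 1) \<le> lam 0"
    using greedy_run_upto_invariant[OF run order_refl] by auto
  have init: "norm (\<iota> (u 0)) = 1" "uses_rayleigh alg \<Longrightarrow> ereal (lam 0) < lambda_dict \<iota> a D"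
    using run by (auto simp: greedy_run_upto_def greedy_init_def)
  have gap: "ereal (a (u (n - 1)) (u (n - 1))) < lambda_dict \<iota> a D" if "uses_rayleigh alg"
    using init(2)[OF that] inv(2,3) by (metis ereal_less_eq(3) order_le_less_trans)
  have "u 0 \<noteq> 0" using init(1) by auto
  then show ?thesis
    unfolding iteration_well_defined_def inv(2)
    using ex_dict_argmin[OF inv(1) gap] dict_argminD(1)[OF inv(1) gap]
      ex_coeff_argmin coeff_argminD(1)
    by (simp del: fun_upd_apply)
qed

section \<open>Infinite runs: decrements, corrections and residuals\<close>

context
  fixes alg z u lam
  assumes run: "greedy_run alg \<iota> a \<nu> D z u lam"
begin

lemma iterates:
  "norm (\<iota> (u n)) = 1" "lam n = a (u n) (u n)" "lam n \<le> lam 0"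
  "is_orthogonal alg \<Longrightarrow> u n \<in> span (insert (u 0) (z ` {1..n}))"
  using greedy_run_upto_invariant[OF greedy_run_imp_upto[OF run] order_refl, of n] by auto

lemma initial_gap: "uses_rayleigh alg \<Longrightarrow> ereal (lam 0) < lambda_dict \<iota> a D"
  using run unfolding greedy_run_def greedy_init_def by blast

lemma step: "greedy_step alg \<iota> a \<nu> D z u lam (Suc n)"
  using run by (simp add: greedy_run_def)

lemma argmin: "dict_argmin alg \<iota> a \<nu> D (u n) (a (u n) (u n)) (z (Suc n))"
  using step[of n] iterates(2)[of n] by (simp add: greedy_step_def)

lemma step_properties:
  shows "lam (Suc n) \<le> quotient (u n + z (Suc n))" "quotient (u n + z (Suc n)) \<le> lam n"
    and "is_orthogonal alg \<Longrightarrow> 0 \<le> \<iota> (u n) \<bullet> \<iota> (u (Suc n))"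
proof -
  have gap: "ereal (lam n) < lambda_dict \<iota> a D" if "uses_rayleigh alg"
    using initial_gap[OF that] iterates(3)[of n] by (meson ereal_less_eq(3) order_le_less_trans)
  note p = greedy_step_properties[OF step iterates(1,2) gap iterates(4,1)]
  show "lam (Suc n) \<le> quotient (u n + z (Suc n))" "quotient (u n + z (Suc n)) \<le> lam n"
    "is_orthogonal alg \<Longrightarrow> 0 \<le> \<iota> (u n) \<bullet> \<iota> (u (Suc n))"
    using p(3,4,6) by auto
qed

lemma decseq_lam: "decseq lam"
  using step_properties(1,2) by (intro decseq_SucI) (meson order_trans)

definition decrement :: "nat \<Rightarrow> real" where
  "decrement n = lam n - lam (Suc n)"

lemma decrement_nonneg: "0 \<le> decrement n"
  using decseq_SucD[OF decseq_lam] by (simp add: decrement_def)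

lemma decrement_ge: "lam n - quotient (u n + z (Suc n)) \<le> decrement n"
  using step_properties(1)[of n] by (simp add: decrement_def)

lemma decrement_tendsto_0: "decrement \<longlonglongrightarrow> 0"
proof -
  have "- \<nu> \<le> lam n" for n
    using quotient_lower[of "u n"] iterates[of n] by (simp add: quotient_def)
  then obtain \<mu> where "lam \<longlonglongrightarrow> \<mu>" using decseq_convergent[OF decseq_lam] by blast
  then have "(\<lambda>n. lam n - lam (Suc n)) \<longlonglongrightarrow> \<mu> - \<mu>" by (intro tendsto_diff LIMSEQ_Suc)
  then show ?thesis by (simp add: decrement_def[abs_def])
qed

lemma residual_correction_energy:
  assumes "\<not> uses_rayleigh alg" "decrement n \<le> 1 / 4"
  shows "energy (z (Suc n)) (z (Suc n)) \<le> 4 * decrement n"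
proof (rule small_energy)
  have "energy (z (Suc n)) (z (Suc n))
      \<le> (a (u n) (u n) - quotient (u n + z (Suc n))) * (1 + norm (\<iota> (z (Suc n))))\<^sup>2"
    using argmin[of n] by (intro residual_step(4)[OF dict_facts(4) iterates(1)])
      (auto simp: argmin_residual_iff[OF assms(1)])
  also have "\<dots> \<le> decrement n * (1 + norm (\<iota> (z (Suc n))))\<^sup>2"
    using decrement_ge[of n] by (intro mult_right_mono) (simp_all add: iterates(2)[symmetric])
  finally show "energy (z (Suc n)) (z (Suc n)) \<le> decrement n * (1 + norm (\<iota> (z (Suc n))))\<^sup>2" .
qed (use assms decrement_nonneg in auto)

lemma rayleigh_correction:
  assumes "uses_rayleigh alg"
  shows "\<exists>l>lam 0. \<forall>n. (l - lam 0) * (norm (\<iota> (z (Suc n))))\<^sup>2 \<le> decrement n"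
    and "\<And>n y. y \<in> D \<Longrightarrow>
      (residual (u n) (quotient (u n + z (Suc n))) y)\<^sup>2 \<le> decrement n * energy y y"
proof -
  \<comment> \<open>\<open>l\<close> is chosen once, for \<open>lam 0\<close>; as
    \<open>lam n \<le> lam 0\<close>, the margin \<open>l - lam 0\<close> is uniform in
    \<open>n\<close>.\<close>
  obtain l where l: "lam 0 < l" "\<And>y. y \<in> D \<Longrightarrow> l * (norm (\<iota> y))\<^sup>2 \<le> a y y"
    using lambda_dict_gap[OF initial_gap[OF assms]] by blast
  have step: "(residual (u n) (quotient (u n + z (Suc n))) y)\<^sup>2
        \<le> (a (u n) (u n) - quotient (u n + z (Suc n))) * energy y y"
      "(l - a (u n) (u n)) * (norm (\<iota> (z (Suc n))))\<^sup>2 \<le> a (u n) (u n) - quotient (u n + z (Suc n))"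
    if "y \<in> D" for n y
  proof -
    have nz: "u n \<noteq> 0" using iterates(1)[of n] by auto
    have less: "a (u n) (u n) < l" using l(1) iterates(2,3)[of n] by simp
    have z: "z (Suc n) \<in> D" "u n + z (Suc n) \<noteq> 0"
      and min: "\<And>y. y \<in> D \<Longrightarrow> u n + y \<noteq> 0 \<Longrightarrow> quotient (u n + z (Suc n)) \<le> quotient (u n + y)"
      using argmin[of n] by (auto simp: argmin_rayleigh_iff[OF assms dict_facts(1) nz])
    note * = rayleigh_step[OF dict_facts(4) iterates(1) z min less l(2)]
    show "(residual (u n) (quotient (u n + z (Suc n))) y)\<^sup>2
        \<le> (a (u n) (u n) - quotient (u n + z (Suc n))) * energy y y"
      by (rule *(2)) (use that in auto)
    show "(l - a (u n) (u n)) * (norm (\<iota> (z (Suc n))))\<^sup>2 \<le> a (u n) (u n) - quotient (u n + z (Suc n))"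
      by (rule *(3)) auto
  qed
  have "(l - lam 0) * (norm (\<iota> (z (Suc n))))\<^sup>2 \<le> decrement n" for n
  proof -
    have "(l - lam 0) * (norm (\<iota> (z (Suc n))))\<^sup>2 \<le> (l - a (u n) (u n)) * (norm (\<iota> (z (Suc n))))\<^sup>2"
      using iterates(2,3)[of n] by (intro mult_right_mono) auto
    also have "\<dots> \<le> decrement n"
      using step(2)[OF dict_facts(1), of n] decrement_ge[of n] iterates(2)[of n] by simp
    finally show ?thesis .
  qed
  with l(1) show "\<exists>l>lam 0. \<forall>n. (l - lam 0) * (norm (\<iota> (z (Suc n))))\<^sup>2 \<le> decrement n"
    by (intro exI[of _ l]) simp
  show "(residual (u n) (quotient (u n + z (Suc n))) y)\<^sup>2 \<le> decrement n * energy y y"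
    if "y \<in> D" for n y
  proof (rule order_trans[OF step(1)[OF that]])
    show "(a (u n) (u n) - quotient (u n + z (Suc n))) * energy y y \<le> decrement n * energy y y"
      using decrement_ge[of n] iterates(2)[of n] by (intro mult_right_mono energy_nonneg) simp
  qed
qed

text \<open>In the Rayleigh case the uniform margin \<open>l - lam 0\<close> gives the decay, in the
  residual case the energy bound for small decrements. It serves to align consecutive iterates of
  the pure algorithms.\<close>

lemma correction_tendsto_0: "(\<lambda>n. norm (\<iota> (z (Suc n)))) \<longlonglongrightarrow> 0"
proof -
  have small: "\<forall>\<^sub>F n in sequentially. decrement n \<le> 1 / 4"
    using order_tendstoD(2)[OF decrement_tendsto_0, of "1 / 4"] by (auto elim: eventually_mono)
  obtain C where C: "\<forall>\<^sub>F n in sequentially. (norm (\<iota> (z (Suc n))))\<^sup>2 \<le> C * decrement n"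
  proof (cases "uses_rayleigh alg")
    case True
    obtain l where l: "lam 0 < l"
      "\<And>n. (l - lam 0) * (norm (\<iota> (z (Suc n))))\<^sup>2 \<le> decrement n"
      using rayleigh_correction(1)[OF True] by blast
    have "(norm (\<iota> (z (Suc n))))\<^sup>2 \<le> (1 / (l - lam 0)) * decrement n" for n
      using l(1) l(2)[of n] by (simp add: pos_le_divide_eq mult.commute)
    then show ?thesis by (intro that[of "1 / (l - lam 0)"]) simp
  next
    case False
    have "\<forall>\<^sub>F n in sequentially. (norm (\<iota> (z (Suc n))))\<^sup>2 \<le> 4 * decrement n"
      using small
    proof eventually_elim
      case (elim n)
      then show ?case
        using residual_correction_energy[OF False elim] norm_H_le_energy[of "z (Suc n)"] by linarith
    qed
    then show ?thesis by (rule that)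
  qed
  have "(\<lambda>n. C * decrement n) \<longlonglongrightarrow> 0"
    using tendsto_mult_right_zero[OF decrement_tendsto_0] by blast
  then have "(\<lambda>n. (norm (\<iota> (z (Suc n))))\<^sup>2) \<longlonglongrightarrow> 0"
    by (rule tendsto_sandwich[OF _ C tendsto_const, rotated 1]) simp
  then show ?thesis by (simp add: power_tendsto_0_iff)
qed

lemma residuals_vanish:
  assumes "y \<in> D"
  shows "(\<lambda>n. residual (u n) (lam n) y) \<longlonglongrightarrow> 0"
proof -
  \<comment> \<open>The root comes from the discriminant, with the factor 4 from
    \<open>small_energy\<close>. The second summand pays for replacing \<open>q\<close> by
    \<open>lam n\<close> in the Rayleigh case.\<close>
  define b where "b n = sqrt (4 * decrement n * energy y y) + decrement n * norm (\<iota> y)" for n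
  have small: "\<forall>\<^sub>F n in sequentially. decrement n \<le> 1 / 4"
    using order_tendstoD(2)[OF decrement_tendsto_0, of "1 / 4"] by (auto elim: eventually_mono)
  have "\<forall>\<^sub>F n in sequentially. \<bar>residual (u n) (lam n) y\<bar> \<le> b n"
    using small
  proof eventually_elim
    case (elim n)
    show ?case
    proof (cases "uses_rayleigh alg")
      case True
      define q where "q = quotient (u n + z (Suc n))"
      have "(residual (u n) q y)\<^sup>2 \<le> decrement n * energy y y"
        unfolding q_def by (rule rayleigh_correction(2)[OF True assms])
      also have "\<dots> \<le> 4 * decrement n * energy y y"
        using decrement_nonneg energy_nonneg by (intro mult_right_mono) auto
      finally have "\<bar>residual (u n) q y\<bar> \<le> sqrt (4 * decrement n * energy y y)"
        by (intro real_le_rsqrt) simp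
      moreover have "\<bar>(lam n - q) * (\<iota> (u n) \<bullet> \<iota> y)\<bar> \<le> decrement n * norm (\<iota> y)"
        unfolding abs_mult
      proof (rule mult_mono)
        show "\<bar>lam n - q\<bar> \<le> decrement n"
          using decrement_ge[of n] step_properties(2)[of n] by (simp add: q_def)
        show "\<bar>\<iota> (u n) \<bullet> \<iota> y\<bar> \<le> norm (\<iota> y)"
          using Cauchy_Schwarz_ineq2[of "\<iota> (u n)" "\<iota> y"] by (simp add: iterates)
      qed (simp_all add: decrement_nonneg)
      moreover have "residual (u n) (lam n) y = residual (u n) q y - (lam n - q) * (\<iota> (u n) \<bullet> \<iota> y)"
        by (simp add: residual_def algebra_simps)
      ultimately show ?thesis unfolding b_def by linarith
    next
      case False
      have "(residual (u n) (a (u n) (u n)) y)\<^sup>2 \<le> energy (z (Suc n)) (z (Suc n)) * energy y y"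
        using argmin[of n] by (intro residual_step(2)[OF dict_facts(4) iterates(1)] assms)
          (auto simp: argmin_residual_iff[OF False])
      also have "\<dots> \<le> 4 * decrement n * energy y y"
        by (intro mult_right_mono residual_correction_energy[OF False elim] energy_nonneg)
      finally have "\<bar>residual (u n) (lam n) y\<bar> \<le> sqrt (4 * decrement n * energy y y)"
        unfolding iterates(2)[symmetric] by (intro real_le_rsqrt) simp
      moreover have "0 \<le> decrement n * norm (\<iota> y)" by (simp add: decrement_nonneg)
      ultimately show ?thesis unfolding b_def by linarith
    qed
  qed
  then have "\<forall>\<^sub>F n in sequentially. norm (residual (u n) (lam n) y) \<le> b n" by simp
  moreover have "b \<longlonglongrightarrow> sqrt (4 * 0 * energy y y) + 0 * norm (\<iota> y)"
    unfolding b_def[abs_def]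
    by (intro tendsto_add tendsto_mult tendsto_real_sqrt tendsto_const decrement_tendsto_0)
  then have "b \<longlonglongrightarrow> 0" by simp
  ultimately show ?thesis by (rule Lim_null_comparison)
qed

text \<open>The sign rule gives this at every step of the orthogonal versions. In the pure ones a
  correction of H-norm below 1 cannot make the inner product of the unit vector
  \<open>\<iota> (u n)\<close> with \<open>\<iota> (u n + z (Suc n))\<close> negative.\<close>

lemma consecutive_aligned: "\<forall>\<^sub>F n in sequentially. 0 \<le> \<iota> (u n) \<bullet> \<iota> (u (Suc n))"
proof (cases "is_orthogonal alg")
  case True
  then show ?thesis using step_properties(3) by simp
next
  case False
  have "\<forall>\<^sub>F n in sequentially. norm (\<iota> (z (Suc n))) < 1"
    using order_tendstoD(2)[OF correction_tendsto_0, of 1] by simp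
  then show ?thesis
  proof eventually_elim
    case (elim n)
    have "u (Suc n) = H_normalize \<iota> (u n + z (Suc n))"
      using step[of n] False by (simp add: greedy_step_def)
    moreover have "\<iota> (u n) \<bullet> \<iota> (u n + z (Suc n)) = 1 + \<iota> (u n) \<bullet> \<iota> (z (Suc n))"
      using iterates(1)[of n] by (simp add: iota.add inner_add_right norm_eq_1)
    moreover have "\<bar>\<iota> (u n) \<bullet> \<iota> (z (Suc n))\<bar> \<le> 1"
      using Cauchy_Schwarz_ineq2[of "\<iota> (u n)" "\<iota> (z (Suc n))"] elim by (simp add: iterates(1))
    ultimately show ?case by (simp add: H_normalize_def iota.scaleR)
  qed
qed

end

end

end

theorem theorem3p1:
  fixes \<iota> :: "'v::{real_inner, complete_space} \<Rightarrow> 'h::{real_inner, complete_space}"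
    and a :: "'v \<Rightarrow> 'v \<Rightarrow> real"
    and D :: "'v set"
    and \<gamma> \<nu> :: real
    and alg :: greedy_alg
  assumes "separable_space (euclidean :: 'v topology)"
    and "separable_space (euclidean :: 'h topology)"
    and "dense_compact_embedding \<iota>"
    and "dictionary D"
    and "bounded_bilinear a"
    and "\<forall>v w. a v w = a w v"
    and "\<gamma> > 0" and "\<nu> > 0"
    and "\<forall>v. a v v \<ge> \<gamma> * (norm v)\<^sup>2 - \<nu> * (norm (\<iota> v))\<^sup>2"
    and "\<forall>v. norm_a \<iota> a \<nu> v \<ge> norm (\<iota> v)"
  shows
    "(\<forall>z u lam. \<forall>n\<ge>1. greedy_run_upto alg \<iota> a \<nu> D z u lam (n - 1) \<longrightarrow>
        iteration_well_defined alg \<iota> a \<nu> D z u lam n)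
     \<and>
     (\<forall>z u lam. greedy_run alg \<iota> a \<nu> D z u lam \<longrightarrow>
        decseq lam \<and>
        (\<exists>\<mu>. lam \<longlonglongrightarrow> \<mu> \<and> is_eigenvalue \<iota> a \<mu> \<and>
          bounded (range u) \<and>
          (\<forall>r w. strict_mono r \<and> limitin weak_topology (u \<circ> r) w sequentially \<longrightarrow>
             (\<exists>\<psi>\<in>normalized_eigenvectors \<iota> a \<mu>. (u \<circ> r) \<longlonglongrightarrow> \<psi>)) \<and>
          (\<lambda>n. INF w\<in>normalized_eigenvectors \<iota> a \<mu>. norm_a \<iota> a \<nu> (w - u n)) \<longlonglongrightarrow> 0 \<and>
          (is_simple_eigenvalue \<iota> a \<mu> \<longrightarrow>
             (\<exists>w\<in>normalized_eigenvectors \<iota> a \<mu>. u \<longlonglongrightarrow> w))))"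
proof -
  interpret compactly_embedded_form \<iota> a \<gamma> \<nu>
    by (rule compactly_embedded_form.intro) (use assms in blast)+
  show ?thesis
  proof (intro conjI allI impI)
    fix z u lam and n :: nat
    assume "greedy_run_upto alg \<iota> a \<nu> D z u lam (n - 1)"
    then show "iteration_well_defined alg \<iota> a \<nu> D z u lam n"
      by (rule iteration_well_defined[OF assms(4)])
  next
    fix z u lam
    assume run: "greedy_run alg \<iota> a \<nu> D z u lam"
    note run = assms(4) run
    show "decseq lam" by (rule decseq_lam[OF run])
    show "\<exists>\<mu>. lam \<longlonglongrightarrow> \<mu> \<and> is_eigenvalue \<iota> a \<mu> \<and> bounded (range u) \<and>
        (\<forall>r w. strict_mono r \<and> limitin weak_topology (u \<circ> r) w sequentially \<longrightarrow>
          (\<exists>\<psi>\<in>normalized_eigenvectors \<iota> a \<mu>. (u \<circ> r) \<longlonglongrightarrow> \<psi>)) \<and>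
        (\<lambda>n. INF w\<in>normalized_eigenvectors \<iota> a \<mu>. norm_a \<iota> a \<nu> (w - u n)) \<longlonglongrightarrow> 0 \<and>
        (is_simple_eigenvalue \<iota> a \<mu> \<longrightarrow> (\<exists>w\<in>normalized_eigenvectors \<iota> a \<mu>. u \<longlonglongrightarrow> w))"
      by (rule vanishing_residuals_convergence[OF iterates(1,2)[OF run] decseq_lam[OF run]
            residuals_vanish[OF run] dict_facts(3)[OF assms(4)] consecutive_aligned[OF run]])
  qed
qed

end
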